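(* Let $n\ge1$ be an integer and $\mathbb{K}=\mathbb{R}$ or $\mathbb{C}$. Let $p_1:\mathbb{S}_1\to\mathbb{P}(\mathbb{K}^{n\times(n+1)})$ and $p_2:\mathbb{S}_2\to\mathbb{P}(\mathbb{K}^{n+1})=\mathbb{P}_n(\mathbb{K})$ be the canonical maps from the unit spheres $\mathbb{S}_1\subset\mathbb{K}^{n\times(n+1)}$ and $\mathbb{S}_2\subset\mathbb{K}^{n+1}$, and let $$\mathcal{W}^>=\left\{(p_1(M),p_2(\zeta))\in\mathbb{P}(\mathbb{K}^{n\times(n+1)})\times\mathbb{P}_n(\mathbb{K}) : M\in\mathbb{GL}_{n,n+1}^>\text{ and }M\zeta=0\right\}.$$ The map $\alpha_2:\mathcal{W}^>\to\mathbb{R}$ given by $\alpha_2(M,\zeta)=\|M\|_F^2/\sigma_n^2(M)$ is self-convex.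
   Context: The singular values of $M\in\mathbb{K}^{n\times (n+1)}$ are $\sigma_1(M)\ge\cdots\ge\sigma_n(M)\ge0$. $\mathbb{GL}_{n,n+1}^>$ is the open set of matrices $M\in\mathbb{K}^{n\times(n+1)}$ of rank $n$ with $\sigma_{n-1}(M)>\sigma_n(M)$ (the smallest singular value is simple). $\|\cdot\|_F$ is the norm of $\langle M,N\rangle_F=\mathrm{trace}(N^*M)$. The value $\alpha_2$ at a point of $\mathcal{W}^>$ is computed with any representatives (it is scale invariant). Each projective space carries the unique Riemannian metric making the canonical projection from the corresponding unit sphere (with the metric induced by the real part of the standard Hermitian product) a Riemannian submersion; $\mathcal{W}^>$ is a Riemannian manifold with the metric induced by the product metric on $\mathbb{P}(\mathbb{K}^{n\times(n+1)})\times\mathbb{P}_n(\mathbb{K})$. Self-convexity: let $(\mathcal{M},\langle\cdot,\cdot\rangle)$ be a Riemannian manifold and $\alpha:\mathcal{M}\to\mathbb{R}$ a $C^2$ function with positive values. Let $\mathcal{M}_\kappa$ be $\mathcal{M}$ with the new metric $\langle\cdot,\cdot\rangle_{\kappa,x}=\alpha(x)\langle\cdot,\cdot\rangle_x$. The function $\alpha$ is self-convex when $t\mapsto\log\alpha(\gamma(t))$ is convex for every geodesic $\gamma$ in $\mathcal{M}_\kappa$. *)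

theory Defs
  imports "HOL-Analysis.Analysis" "HOL-Computational_Algebra.Polynomial"
begin

section \<open>The scalar field\<close>

text \<open>A common name for the two scalar fields, the reals and the complex numbers, which are
  the only models of the axioms. As \<open>mult_cconj\<close> shows, \<open>cconj\<close> is determined by the norm.\<close>

class rc_scalar = real_normed_field + euclidean_space +
  fixes cconj :: "'a \<Rightarrow> 'a"
  assumes cconj_add: "cconj (x + y) = cconj x + cconj y"
    and mult_cconj: "x * cconj x = (norm x)\<^sup>2 *\<^sub>R 1"

instantiation real :: rc_scalar
begin
definition cconj_real :: "real \<Rightarrow> real" where "cconj_real x = x"
instance by standard (simp_all add: cconj_real_def power2_eq_square)
end

instantiation complex :: rc_scalar
begin
definition cconj_complex :: "complex \<Rightarrow> complex" where "cconj_complex = cnj"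
instance
proof
  fix x y :: complex
  show "cconj (x + y) = cconj x + cconj y"
    by (simp add: cconj_complex_def)
  show "x * cconj x = (norm x)\<^sup>2 *\<^sub>R 1"
    by (metis cconj_complex_def complex_norm_square scaleR_conv_of_real mult_1_right)
qed
end

section \<open>Singular values\<close>

definition adjoint_mat :: "'k::rc_scalar^'m^'n \<Rightarrow> 'k^'n^'m" where
  "adjoint_mat M = (\<chi> i j. cconj (M $ j $ i))"

definition charpoly :: "'k::field^'n^'n \<Rightarrow> 'k poly" where
  "charpoly A = det (\<chi> i j. if i = j then [:- (A $ i $ j), 1:] else [:- (A $ i $ j):])"

text \<open>The square roots of the eigenvalues of \<open>M M\<^sup>*\<close>, with multiplicity, in nonincreasing order;
  these are as many as the rows of \<open>M\<close>. The eigenvalues are nonnegative reals inside \<open>'k\<close>, so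
  that \<open>norm\<close> merely turns them into elements of type \<^typ>\<open>real\<close>.\<close>

definition singular_values :: "'k::rc_scalar^'m^'n \<Rightarrow> real list" where
  "singular_values M =
     rev (sorted_list_of_multiset
       (image_mset (\<lambda>c. sqrt (norm c)) (proots (charpoly (M ** adjoint_mat M)))))"

definition sigma :: "nat \<Rightarrow> 'k::rc_scalar^'m^'n \<Rightarrow> real" where
  "sigma k M = singular_values M ! (k - 1)"

text \<open>For a single row there is only one singular value, which is then simple.\<close>

definition GL_gt :: "('k::rc_scalar^'m^'n) set" where
  "GL_gt = {M. rank M = CARD('n) \<and>
     (CARD('n) \<ge> 2 \<longrightarrow> sigma (CARD('n) - 1) M > sigma CARD('n) M)}"

section \<open>Maps of class \<open>C\<^sup>k\<close> on open sets\<close>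

primrec Ck_on :: "nat \<Rightarrow> 'a::real_normed_vector set \<Rightarrow> ('a \<Rightarrow> 'b::real_normed_vector) \<Rightarrow> bool" where
  "Ck_on 0 U f \<longleftrightarrow> continuous_on U f"
| "Ck_on (Suc k) U f \<longleftrightarrow> (\<forall>x\<in>U. f differentiable (at x)) \<and>
     (\<forall>v. Ck_on k U (\<lambda>x. frechet_derivative f (at x) v))"

definition smooth_map_on :: "'a::real_normed_vector set \<Rightarrow> ('a \<Rightarrow> 'b::real_normed_vector) \<Rightarrow> bool" where
  "smooth_map_on U f \<longleftrightarrow> (\<forall>k. Ck_on k U f)"

section \<open>Geodesics and self-convexity in a Riemannian manifold\<close>

text \<open>A Riemannian manifold with points of type \<open>'p\<close>, modelled on \<open>'e\<close>, is presented by an atlas of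
  local parametrizations \<open>chart_map\<close>, defined on open sets \<open>chart_dom\<close>, together with the expression
  \<open>chart_metric x u v\<close> of the metric in each of them, where \<open>x\<close> is the base point.\<close>

record ('e, 'p) riem_chart =
  chart_dom :: "'e set"
  chart_map :: "'e \<Rightarrow> 'p"
  chart_metric :: "'e \<Rightarrow> 'e \<Rightarrow> 'e \<Rightarrow> real"

text \<open>Christoffel symbols of the first kind: \<open>christoffel g x u v w\<close> is the inner product of
  \<open>\<nabla>\<^sub>u v\<close> (for constant vector fields, with the Levi-Civita connection) with \<open>w\<close>, by Koszul's
  formula.\<close>

definition christoffel ::
  "('e::euclidean_space \<Rightarrow> 'e \<Rightarrow> 'e \<Rightarrow> real) \<Rightarrow> 'e \<Rightarrow> 'e \<Rightarrow> 'e \<Rightarrow> 'e \<Rightarrow> real" where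
  "christoffel g x u v w =
     (frechet_derivative (\<lambda>y. g y v w) (at x) u
      + frechet_derivative (\<lambda>y. g y u w) (at x) v
      - frechet_derivative (\<lambda>y. g y u v) (at x) w) / 2"

text \<open>The last condition says that the covariant acceleration \<open>c'' + \<Gamma>(c', c')\<close> vanishes, by pairing
  it with all \<open>w\<close>. It does not depend on the chart around \<open>\<gamma> t\<close>.\<close>

definition geodesic ::
  "('e::euclidean_space, 'p) riem_chart set \<Rightarrow> real set \<Rightarrow> (real \<Rightarrow> 'p) \<Rightarrow> bool" where
  "geodesic A I \<gamma> \<longleftrightarrow> is_interval I \<and>
     (\<forall>t\<in>I. \<exists>\<phi>\<in>A. \<exists>\<delta>>0. \<exists>c c' c''. \<forall>s\<in>I. \<bar>s - t\<bar> < \<delta> \<longrightarrow>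
        c s \<in> chart_dom \<phi> \<and> \<gamma> s = chart_map \<phi> (c s) \<and>
        (c has_vector_derivative c' s) (at s within I) \<and>
        (c' has_vector_derivative c'' s) (at s within I) \<and>
        (\<forall>w. chart_metric \<phi> (c s) (c'' s) w
              + christoffel (chart_metric \<phi>) (c s) (c' s) (c' s) w = 0))"

definition conformal_change ::
  "('p \<Rightarrow> real) \<Rightarrow> ('e, 'p) riem_chart set \<Rightarrow> ('e, 'p) riem_chart set" where
  "conformal_change \<alpha> A =
     (\<lambda>\<phi>. \<phi>\<lparr>chart_metric := (\<lambda>x u v. \<alpha> (chart_map \<phi> x) * chart_metric \<phi> x u v)\<rparr>) ` A"

definition self_convex ::
  "('e::euclidean_space, 'p) riem_chart set \<Rightarrow> ('p \<Rightarrow> real) \<Rightarrow> bool" where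
  "self_convex A \<alpha> \<longleftrightarrow>
     (\<forall>\<phi>\<in>A. Ck_on 2 (chart_dom \<phi>) (\<lambda>x. \<alpha> (chart_map \<phi> x)) \<and>
            (\<forall>x\<in>chart_dom \<phi>. \<alpha> (chart_map \<phi> x) > 0)) \<and>
     (\<forall>I \<gamma>. geodesic (conformal_change \<alpha> A) I \<gamma> \<longrightarrow> convex_on I (\<lambda>t. ln (\<alpha> (\<gamma> t))))"

section \<open>Projective spaces\<close>

text \<open>The projective space of a \<open>'k\<close>-vector space \<open>'v\<close>, with scalar multiplication \<open>sc\<close>, consists of
  lines; \<open>proj sc\<close> maps a unit vector to the line through it. The inner product of \<open>'v\<close> is the real
  part of the standard Hermitian product, which on matrices is the Frobenius product.\<close>

definition proj :: "('k \<Rightarrow> 'v \<Rightarrow> 'v) \<Rightarrow> 'v \<Rightarrow> 'v set" where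
  "proj sc x = range (\<lambda>c. sc c x)"

definition mat_scale :: "'k::times \<Rightarrow> 'k^'m^'n \<Rightarrow> 'k^'m^'n" where
  "mat_scale c M = (\<chi> i j. c * M $ i $ j)"

text \<open>The fibre of \<open>proj sc\<close> in the unit sphere through \<open>x\<close> is the set of all \<open>sc c x\<close> with
  \<open>norm c = 1\<close>. Its tangent space at \<open>x\<close>, the kernel of the differential of \<open>proj sc\<close>, is vertical;
  the orthogonal complement of the latter in the tangent space of the sphere is horizontal.\<close>

definition vertical :: "('k::rc_scalar \<Rightarrow> 'v \<Rightarrow> 'v) \<Rightarrow> 'v::real_inner \<Rightarrow> 'v set" where
  "vertical sc x = {sc c x | c. inner c 1 = 0}"

definition horizontal :: "('k::rc_scalar \<Rightarrow> 'v \<Rightarrow> 'v) \<Rightarrow> 'v::real_inner \<Rightarrow> 'v set" where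
  "horizontal sc x = {v. inner v x = 0 \<and> (\<forall>w\<in>vertical sc x. inner v w = 0)}"

definition hor_part :: "('k::rc_scalar \<Rightarrow> 'v \<Rightarrow> 'v) \<Rightarrow> 'v::real_inner \<Rightarrow> 'v \<Rightarrow> 'v" where
  "hor_part sc x v = (THE h. h \<in> horizontal sc x \<and> v - h \<in> vertical sc x)"

text \<open>For \<open>u\<close> and \<open>v\<close> tangent to the sphere at \<open>x\<close>, the inner product of their images under the
  differential of \<open>proj sc\<close>, for the metric which makes \<open>proj sc\<close> a Riemannian submersion.\<close>

definition proj_metric ::
  "('k::rc_scalar \<Rightarrow> 'v \<Rightarrow> 'v) \<Rightarrow> 'v::real_inner \<Rightarrow> 'v \<Rightarrow> 'v \<Rightarrow> real" where
  "proj_metric sc x u v = inner (hor_part sc x u) (hor_part sc x v)"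

section \<open>Submanifolds of the product of two projective spaces\<close>

type_synonym ('k, 'm, 'n) pp_point = "('k^'m^'n) set \<times> ('k^'m) set"

definition pp_proj :: "('k::rc_scalar^'m^'n) \<times> ('k^'m) \<Rightarrow> ('k, 'm, 'n) pp_point" where
  "pp_proj q = (proj mat_scale (fst q), proj (*s) (snd q))"

definition pp_metric ::
  "('k::rc_scalar^'m^'n) \<times> ('k^'m) \<Rightarrow> ('k^'m^'n) \<times> ('k^'m) \<Rightarrow> ('k^'m^'n) \<times> ('k^'m) \<Rightarrow> real" where
  "pp_metric q u v = proj_metric mat_scale (fst q) (fst u) (fst v)
                   + proj_metric (*s) (snd q) (snd u) (snd v)"

definition sphere_lift ::
  "('k::rc_scalar, 'm::finite, 'n::finite) pp_point set \<Rightarrow> (('k^'m^'n) \<times> ('k^'m)) set" where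
  "sphere_lift W = {q \<in> sphere 0 1 \<times> sphere 0 1. pp_proj q \<in> W}"

definition pullback_metric ::
  "('e::euclidean_space \<Rightarrow> ('k::rc_scalar^'m^'n) \<times> ('k^'m)) \<Rightarrow> 'e \<Rightarrow> 'e \<Rightarrow> 'e \<Rightarrow> real" where
  "pullback_metric F x u v =
     pp_metric (F x) (frechet_derivative F (at x) u) (frechet_derivative F (at x) v)"

text \<open>The local parametrizations of a submanifold \<open>W\<close> which possess a smooth lift \<open>F\<close> to the product
  of the spheres (every local parametrization has such lifts locally), with the induced metric: the
  composite with the projection is an injective immersion into \<open>W\<close> and is open as a map to \<open>W\<close> (for
  the subspace topology of the product of the quotient topologies, hence tested on preimages).\<close>

definition submanifold_charts ::
  "('k::rc_scalar, 'm::finite, 'n::finite) pp_point set \<Rightarrow>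
     ('e::euclidean_space, ('k, 'm, 'n) pp_point) riem_chart set" where
  "submanifold_charts W =
     {\<lparr>chart_dom = U, chart_map = (\<lambda>x. pp_proj (F x)), chart_metric = pullback_metric F\<rparr> | U F.
        open U \<and> smooth_map_on U F \<and> F ` U \<subseteq> sphere_lift W \<and>
        inj_on (\<lambda>x. pp_proj (F x)) U \<and>
        (\<forall>x\<in>U. \<forall>u. u \<noteq> 0 \<longrightarrow> pullback_metric F x u u > 0) \<and>
        (\<forall>V\<subseteq>U. open V \<longrightarrow>
           openin (top_of_set (sphere_lift W))
             {q \<in> sphere_lift W. pp_proj q \<in> (\<lambda>x. pp_proj (F x)) ` V})}"

section \<open>The solution variety and the condition number\<close>

definition W_gt :: "('k::rc_scalar, 'm::finite, 'n::finite) pp_point set" where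
  "W_gt = {(proj mat_scale M, proj (*s) \<zeta>) | M \<zeta>.
     M \<in> sphere 0 1 \<and> \<zeta> \<in> sphere 0 1 \<and> M \<in> GL_gt \<and> M *v \<zeta> = 0}"

definition alpha2 :: "('k::rc_scalar, 'm::finite, 'n::finite) pp_point \<Rightarrow> real" where
  "alpha2 p = (THE a. \<exists>M\<in>fst p. M \<noteq> 0 \<and> a = (norm M)\<^sup>2 / (sigma CARD('n) M)\<^sup>2)"

end

theory Submission
  imports Defs
begin

text \<open>Let \<open>f = \<sigma>\<^sub>n\<^sup>2\<close> on unit matrices, so that \<open>\<alpha>\<^sub>2 = 1/f\<close>. For a curve which is a geodesic of the metric
  multiplied by \<open>1/f\<close>, convexity of \<open>- ln f\<close> means \<open>f f'' \<le> f'\<^sup>2\<close>. Two facts make this true.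

  The first is that \<open>f\<close> is a minimum of simple functions: \<open>f(M)\<close> is the least value of
  \<open>\<parallel>M\<^sup>* u\<parallel>\<^sup>2\<close> over the unit vectors \<open>u\<close> (\<open>smallest_singular_value\<close>). Fix a minimizing \<open>u\<close> at a given
  point. There the function \<open>\<parallel>M\<^sup>* u\<parallel>\<^sup>2\<close> touches \<open>f\<close> from above, so it has the same first
  derivative and its second derivative bounds that of \<open>f\<close>. With \<open>Y = u (M\<^sup>* u)\<^sup>*\<close> this gives
  \<open>f' = 2 \<langle>M', Y\<rangle>\<close> and \<open>f'' \<le> 2 \<parallel>M'\<^sup>* u\<parallel>\<^sup>2 + 2 \<langle>M'', Y\<rangle>\<close>.

  The second is that \<open>W = Y - f M\<close>, with second component zero, is a tangent vector of the solution
  variety: it is horizontal, and \<open>W \<zeta> = 0\<close> because \<open>M \<zeta> = 0\<close> (\<open>tangent_space_contains\<close>). It is half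
  the gradient of \<open>f\<close>, and \<open>\<parallel>W\<parallel>\<^sup>2 = f (1 - f)\<close>. The geodesic equation tested against this single
  vector expresses \<open>\<langle>M'', W\<rangle>\<close> by first-order data, and \<open>\<langle>M'', M\<rangle> = - \<parallel>M'\<parallel>\<^sup>2\<close> since \<open>\<parallel>M\<parallel> = 1\<close>. If the lift
  \<open>(M, \<zeta>)\<close> is horizontal, the outcome is
  \<open>f'' \<le> f'\<^sup>2/f + 2 \<parallel>M'\<^sup>* u\<parallel>\<^sup>2 - 2 f \<parallel>M'\<parallel>\<^sup>2 - 2 (1 - f) (\<parallel>M'\<parallel>\<^sup>2 + \<parallel>\<zeta>'\<parallel>\<^sup>2)\<close>,
  and \<open>\<parallel>M'\<^sup>* u\<parallel> \<le> \<parallel>M'\<parallel>\<close> and \<open>f \<le> 1\<close> finish the proof. For an arbitrary lift the terms caused by its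
  vertical velocity cancel (\<open>core_inequality\<close>). The curvature of the solution variety never enters,
  as the normal component of the acceleration is orthogonal to \<open>W\<close>.

  That \<open>f\<close> is of class \<open>C\<^sup>2\<close> follows from the simplicity of the smallest singular value: \<open>f\<close> is a
  continuous simple root of the characteristic polynomial of \<open>M M\<^sup>*\<close>, and such a root is as smooth
  as the coefficients (\<open>simple_root_Ck\<close>). Identifying the root with the minimum of the Rayleigh
  quotient takes the spectral theorem (\<open>hermitian_spectral\<close>).

  Everything is done for both scalar fields at once.\<close>

section \<open>Real and complex scalars\<close>

text \<open>Polarization of the axiom relating the conjugation to the norm.\<close>

lemma scalar_mult_cconj_add:
  fixes x y :: "'k::rc_scalar"
  shows "x * cconj y + y * cconj x = (2 * inner x y) *\<^sub>R 1"
proof -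
  have "(x + y) * cconj (x + y) = (norm (x + y))\<^sup>2 *\<^sub>R 1"
    by (rule mult_cconj)
  moreover have "(x + y) * cconj (x + y) = x * cconj x + y * cconj y + (x * cconj y + y * cconj x)"
    by (simp add: cconj_add algebra_simps)
  moreover have "(norm (x + y))\<^sup>2 = (norm x)\<^sup>2 + (norm y)\<^sup>2 + 2 * inner x y"
    by (simp add: power2_norm_eq_inner inner_add inner_commute)
  ultimately show ?thesis
    by (simp add: mult_cconj scaleR_add_left)
qed

lemma cconj_0 [simp]: "cconj 0 = (0::'k::rc_scalar)"
  using cconj_add[of 0 "0::'k"] by simp

text \<open>Since the conjugation is determined by the norm, its multiplicativity and involutivity come from
  the multiplicativity of the norm.\<close>

lemma cconj_eq_divide: "x \<noteq> 0 \<Longrightarrow> cconj x = of_real ((norm x)\<^sup>2) / (x::'k::rc_scalar)"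
  using mult_cconj[of x] by (simp add: field_simps of_real_def)

lemma cconj_mult: "cconj (x * y) = cconj x * cconj (y::'k::rc_scalar)"
  by (cases "x = 0 \<or> y = 0") (auto simp: cconj_eq_divide norm_mult power_mult_distrib)

lemma norm_cconj [simp]: "norm (cconj x) = norm (x::'k::rc_scalar)"
  by (cases "x = 0") (auto simp: cconj_eq_divide norm_divide power2_eq_square simp flip: of_real_mult)

lemma cconj_cconj [simp]: "cconj (cconj x) = (x::'k::rc_scalar)"
proof (cases "x = 0")
  case False
  then have "cconj x \<noteq> 0" by (metis norm_cconj norm_eq_zero)
  then have "cconj (cconj x) = of_real ((norm x)\<^sup>2) / cconj x"
    by (simp add: cconj_eq_divide[of "cconj x"])
  also have "\<dots> = x"
    using False by (simp add: cconj_eq_divide)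
  finally show ?thesis .
qed simp

lemma cconj_of_real [simp]: "cconj (of_real r) = (of_real r :: 'k::rc_scalar)"
  by (cases "r = 0") (auto simp: cconj_eq_divide power2_eq_square simp flip: of_real_mult of_real_divide)

lemma cconj_scaleR: "cconj (r *\<^sub>R x) = r *\<^sub>R cconj (x::'k::rc_scalar)"
  by (simp add: scaleR_conv_of_real cconj_mult)

lemma bounded_linear_cconj: "bounded_linear (cconj :: 'k \<Rightarrow> 'k::rc_scalar)"
  by (rule bounded_linear_intro[of _ 1]) (auto simp: cconj_add cconj_scaleR)

lemma cconj_sum: "cconj (sum f A) = (\<Sum>x\<in>A. cconj (f x :: 'k::rc_scalar))"
  by (induction A rule: infinite_finite_induct) (auto simp: cconj_add)

lemma scalar_inner_one_one [simp]: "inner 1 (1::'k::rc_scalar) = 1"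
  by (metis norm_eq_1 norm_one)

lemma inner_of_real_one [simp]: "inner (of_real r) (1::'k::rc_scalar) = r"
  by (simp add: of_real_def)

lemma scalar_inner_eq_mult_cconj:
  "inner x y = inner (x * cconj y) (1::'k::rc_scalar)"
proof -
  have "inner (x * cconj y) 1 + inner (y * cconj x) (1::'k) = 2 * inner x y"
    using arg_cong[OF scalar_mult_cconj_add[of x y], of "\<lambda>z. inner z 1"]
    by (simp add: inner_add_left)
  moreover have "inner (cconj z) 1 = inner z (1::'k)" for z
  proof -
    have "z + cconj z = (2 * inner z 1) *\<^sub>R (1::'k)"
      using scalar_mult_cconj_add[of z 1] cconj_of_real[where 'k='k, of 1] by simp
    from arg_cong[OF this, of "\<lambda>z. inner z 1"] show ?thesis
      by (simp add: inner_add_left)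
  qed
  from this[of "x * cconj y"] have "inner (y * cconj x) 1 = inner (x * cconj y) (1::'k)"
    by (simp add: cconj_mult mult.commute)
  ultimately show ?thesis by simp
qed

lemma inner_cconj_one: "inner (cconj z) 1 = inner z (1::'k::rc_scalar)"
  using scalar_inner_eq_mult_cconj[of 1 z] cconj_of_real[where 'k='k, of 1] by (simp add: inner_commute)

lemma scalar_inner_mult_left:
  "inner (c * x) y = inner x (cconj c * (y::'k::rc_scalar))"
  by (simp add: scalar_inner_eq_mult_cconj[of "c * x"] scalar_inner_eq_mult_cconj[of x] cconj_mult mult_ac)

lemma add_cconj: "z + cconj z = of_real (2 * inner z (1::'k::rc_scalar))"
  using scalar_mult_cconj_add[of z 1] cconj_of_real[where 'k='k, of 1] by (simp add: of_real_def)

lemma imaginary_cconj: "inner c 1 = 0 \<Longrightarrow> cconj c = - (c::'k::rc_scalar)"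
  using add_cconj[of c] by (simp add: eq_neg_iff_add_eq_0 add.commute)

section \<open>Hermitian products\<close>

text \<open>Matrices and vectors are treated alike, as spaces with a scalar multiplication whose adjoint is
  multiplication by the conjugate. The Hermitian product is recovered from its real part.\<close>

locale hermitian_space =
  fixes sc :: "'k::rc_scalar \<Rightarrow> 'v::euclidean_space \<Rightarrow> 'v"
  assumes bilinear_sc: "bounded_bilinear sc"
    and sc_sc: "sc a (sc b x) = sc (a * b) x"
    and sc_one [simp]: "sc 1 x = x"
    and inner_sc_left: "inner (sc c x) y = inner x (sc (cconj c) y)"
begin

sublocale sc: bounded_bilinear sc by (rule bilinear_sc)

definition hm :: "'v \<Rightarrow> 'v \<Rightarrow> 'k" where
  "hm x y = (\<Sum>b\<in>Basis. inner x (sc b y) *\<^sub>R b)"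

lemma inner_hm: "inner (hm x y) c = inner x (sc c y)"
proof -
  have "sc c y = (\<Sum>b\<in>Basis. inner c b *\<^sub>R sc b y)"
    by (subst (1) euclidean_representation[of c, symmetric])
      (simp only: sc.sum_left sc.scaleR_left)
  then show ?thesis
    by (simp add: hm_def inner_sum_left inner_sum_right inner_commute mult_ac)
qed

lemma hm_eqI: "(\<And>c. inner x (sc c y) = inner z c) \<Longrightarrow> hm x y = z"
  by (rule vector_eq_rdot[THEN iffD1]) (auto simp: inner_hm)

lemma bilinear_hm: "bounded_bilinear hm"
  unfolding hm_def
  by (auto intro!: bounded_bilinear.flip[OF bounded_bilinear.comp1] bilinear_conv_bounded_bilinear[THEN iffD1]
      simp: bilinear_def linear_iff inner_add sc.add_right sc.scaleR_right sum.distrib scaleR_add_left scaleR_sum_right)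

sublocale hm: bounded_bilinear hm by (rule bilinear_hm)

lemma sc_of_real: "sc (of_real r) x = r *\<^sub>R x"
  by (simp add: of_real_def sc.scaleR_left)

lemma inner_sc_self: "inner (sc c x) x = inner c 1 * (norm x)\<^sup>2"
proof -
  have "2 * inner (sc c x) x = inner (sc c x) x + inner (sc (cconj c) x) x"
    using inner_sc_left[of c x x] by (simp add: inner_commute)
  also have "\<dots> = inner (sc (c + cconj c) x) x"
    by (simp add: sc.add_left inner_add_left)
  also have "\<dots> = 2 * (inner c 1 * (norm x)\<^sup>2)"
    by (simp add: add_cconj sc_of_real power2_norm_eq_inner del: of_real_mult)
  finally show ?thesis by simp
qed

lemma inner_sc_sc: "inner (sc c x) (sc d x) = inner c d * (norm x)\<^sup>2"
proof -
  have "inner (sc c x) (sc d x) = inner (sc (cconj d * c) x) x"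
    using inner_sc_left[of "cconj d" "sc c x" x] by (simp add: sc_sc)
  also have "\<dots> = inner c d * (norm x)\<^sup>2"
    by (simp add: inner_sc_self scalar_inner_eq_mult_cconj[of c d] mult.commute)
  finally show ?thesis .
qed

lemma norm_sc: "norm (sc c x) = norm c * norm x"
  using inner_sc_sc[of c x c]
  by (metis norm_eq_sqrt_inner power2_norm_eq_inner real_sqrt_mult norm_ge_zero real_sqrt_unique)

lemma hm_sc_self: "norm x = 1 \<Longrightarrow> hm (sc c x) x = c"
  by (rule hm_eqI) (simp add: inner_sc_sc)

lemma inner_hm_one: "inner (hm x y) 1 = inner x y"
  by (simp add: inner_hm)

lemma hm_commute: "hm y x = cconj (hm x y)"
proof (rule hm_eqI)
  fix c
  have "inner y (sc c x) = inner (hm x y) (cconj c)"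
    by (metis inner_hm inner_sc_left inner_commute)
  also have "\<dots> = inner (cconj (hm x y)) c"
    by (metis cconj_cconj mult.commute scalar_inner_eq_mult_cconj inner_cconj_one cconj_mult)
  finally show "inner y (sc c x) = inner (cconj (hm x y)) c" .
qed

lemma hm_self: "hm x x = of_real ((norm x)\<^sup>2)"
proof (rule hm_eqI)
  fix c
  show "inner x (sc c x) = inner (of_real ((norm x)\<^sup>2)) c"
    using inner_sc_self[of c x] by (simp add: of_real_def inner_commute mult.commute)
qed

text \<open>Subtracting the projection to the whole line through \<open>x\<close> amounts to subtracting a vertical vector,
  because the Hermitian product of a tangent vector with \<open>x\<close> is imaginary.\<close>

lemma hor_part_tangent:
  assumes x: "norm x = 1" and v: "inner v x = 0"
  shows "hor_part sc x v = v - sc (hm v x) x"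
  unfolding hor_part_def
proof (rule the_equality)
  let ?h = "v - sc (hm v x) x"
  have ortho: "inner ?h (sc c x) = 0" for c
    using x by (simp add: inner_diff_left inner_sc_sc inner_hm)
  have im: "inner (hm v x) 1 = 0"
    using v by (simp add: inner_hm)
  show h: "?h \<in> horizontal sc x \<and> v - ?h \<in> vertical sc x"
    using ortho[of 1] ortho im by (auto simp: horizontal_def vertical_def)
  fix h assume "h \<in> horizontal sc x \<and> v - h \<in> vertical sc x"
  then obtain c where c: "v - h = sc c x" and hx: "inner h x = 0"
    and hh: "\<And>d. inner d 1 = 0 \<Longrightarrow> inner h (sc d x) = 0"
    by (auto simp: horizontal_def vertical_def)
  have "inner (hm h x) (hm h x) = 0"
    using hh[of "hm h x"] hx by (simp add: inner_hm)
  moreover have "hm v x = hm h x + c"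
    using x c by (metis add.commute diff_add_cancel hm.add_left hm_sc_self)
  ultimately show "h = ?h"
    by (simp flip: c)
qed

text \<open>On tangent vectors the quotient metric agrees with a form which makes sense for all vectors,
  and which is polynomial in the base point.\<close>

definition fubini_study :: "'v \<Rightarrow> 'v \<Rightarrow> 'v \<Rightarrow> real" where
  "fubini_study x u v = inner u v - inner (hm u x) (hm v x)"

lemma proj_metric_tangent:
  assumes x: "norm x = 1" and "inner u x = 0" "inner v x = 0"
  shows "proj_metric sc x u v = fubini_study x u v"
proof -
  have "inner v (sc (hm u x) x) = inner (hm u x) (hm v x)" "inner u (sc (hm v x) x) = inner (hm u x) (hm v x)"
    by (simp_all only: inner_hm[symmetric] inner_commute)
  then show ?thesis
    using assms
    by (simp add: proj_metric_def hor_part_tangent fubini_study_def inner_diff_left inner_diff_right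
        inner_sc_sc inner_commute)
qed

text \<open>The quadratic form is the squared length of the horizontal part, hence nonnegative.\<close>

lemma fubini_study_self:
  assumes "norm x = 1"
  shows "fubini_study x u u = (norm (u - sc (hm u x) x))\<^sup>2"
  using assms
  by (simp add: fubini_study_def power2_norm_eq_inner inner_diff_left inner_diff_right
      inner_sc_sc inner_hm inner_commute)

lemma fubini_study_vertical:
  "norm x = 1 \<Longrightarrow> fubini_study x u (sc c x) = 0"
  by (simp add: fubini_study_def hm_sc_self inner_hm)

lemma fubini_study_horizontal:
  "hm v x = 0 \<Longrightarrow> fubini_study x u v = inner u v"
  by (simp add: fubini_study_def)

end

lemma hermitian_space_vec: "hermitian_space ((*s) :: 'k::rc_scalar \<Rightarrow> 'k^'m \<Rightarrow> 'k^'m)"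
proof
  show "(a *s (b *s x)) = (a * b) *s x" for a b and x :: "'k^'m"
    by simp
  show "1 *s x = x" for x :: "'k^'m"
    by simp
  show "inner (c *s x) y = inner x (cconj c *s y)" for c and x y :: "'k^'m"
    by (simp add: inner_vec_def scalar_inner_mult_left)
  show "\<exists>K. \<forall>a (b::'k^'m). norm (a *s b) \<le> norm a * norm b * K"
    by (rule exI[of _ 1])
      (simp add: norm_vec_def norm_mult L2_set_right_distrib)
qed (auto simp: vec_eq_iff algebra_simps)

lemma hermitian_space_mat:
  "hermitian_space (mat_scale :: 'k::rc_scalar \<Rightarrow> 'k^'m^'n \<Rightarrow> 'k^'m^'n)"
proof
  have rows: "mat_scale a x = (\<chi> i. a *s x $ i)" for a and x :: "'k^'m^'n"
    by (simp add: mat_scale_def vec_eq_iff)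
  show "mat_scale a (mat_scale b x) = mat_scale (a * b) x" for a b and x :: "'k^'m^'n"
    by (simp add: mat_scale_def mult.assoc)
  show "mat_scale 1 x = x" for x :: "'k^'m^'n"
    by (simp add: mat_scale_def)
  show "inner (mat_scale c x) y = inner x (mat_scale (cconj c) y)" for c and x y :: "'k^'m^'n"
    by (simp add: inner_vec_def mat_scale_def scalar_inner_mult_left)
  show "\<exists>K. \<forall>a (b::'k^'m^'n). norm (mat_scale a b) \<le> norm a * norm b * K"
    by (rule exI[of _ 1])
      (simp add: norm_vec_def mat_scale_def norm_mult L2_set_right_distrib)
qed (auto simp: vec_eq_iff mat_scale_def algebra_simps)

interpretation vec_herm: hermitian_space "(*s) :: 'k::rc_scalar \<Rightarrow> 'k^'m \<Rightarrow> 'k^'m"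
  by (rule hermitian_space_vec)

interpretation mat_herm: hermitian_space "mat_scale :: 'k::rc_scalar \<Rightarrow> 'k^'m^'n \<Rightarrow> 'k^'m^'n"
  by (rule hermitian_space_mat)

section \<open>Functions of class \<open>C\<^sup>k\<close>\<close>

abbreviation dir :: "('a::real_normed_vector \<Rightarrow> 'b::real_normed_vector) \<Rightarrow> 'a \<Rightarrow> 'a \<Rightarrow> 'b" where
  "dir f v x \<equiv> frechet_derivative f (at x) v"

text \<open>The derivative is only prescribed on \<open>U\<close>, while iterated derivatives are values of a total function,
  so that congruence of the class \<open>C\<^sup>k\<close> is required. It is a premise because it is itself proved by
  induction with this rule.\<close>

lemma Ck_on_SucI:
  assumes "open U" and "\<And>x. x \<in> U \<Longrightarrow> (f has_derivative f' x) (at x)"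
    and "\<And>v. Ck_on k U (\<lambda>x. f' x v)"
    and cong: "\<And>f g :: 'a::real_normed_vector \<Rightarrow> 'b::real_normed_vector. (\<And>x. x \<in> U \<Longrightarrow> f x = g x) \<Longrightarrow> Ck_on k U f \<Longrightarrow> Ck_on k U g"
  shows "Ck_on (Suc k) U (f :: 'a \<Rightarrow> 'b)"
proof -
  have eq: "frechet_derivative f (at x) = f' x" if "x \<in> U" for x
    using frechet_derivative_at[OF assms(2)[OF that]] by simp
  have "Ck_on k U (dir f v)" for v
    by (rule cong[OF _ assms(3)[of v]]) (simp add: eq)
  then show ?thesis
    using assms(2) by (auto simp: differentiable_def)
qed

lemma Ck_on_cong:
  assumes "open U" and "\<And>x. x \<in> U \<Longrightarrow> f x = g x" and "Ck_on k U f"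
  shows "Ck_on k U g"
  using assms(2,3)
proof (induction k arbitrary: f g)
  case 0
  then show ?case by (simp cong: continuous_on_cong)
next
  case (Suc k)
  have "(g has_derivative frechet_derivative f (at x)) (at x)" if "x \<in> U" for x
    using Suc.prems that frechet_derivative_works[of f "at x"]
    by (auto intro: has_derivative_transform_within_open[OF _ \<open>open U\<close> that, of f])
  then show ?case
    using Suc.prems(2) by (intro Ck_on_SucI[OF \<open>open U\<close>]) (auto intro: Suc.IH)
qed

lemmas Ck_on_SucI' = Ck_on_SucI[OF _ _ _ Ck_on_cong]

lemma Ck_on_has_derivative:
  "Ck_on (Suc k) U f \<Longrightarrow> x \<in> U \<Longrightarrow> (f has_derivative frechet_derivative f (at x)) (at x)"
  by (simp add: frechet_derivative_works)

lemma Ck_on_SucD: "Ck_on (Suc k) U f \<Longrightarrow> Ck_on k U f"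
proof (induction k arbitrary: f)
  case 0
  then show ?case
    by (auto intro!: continuous_at_imp_continuous_on differentiable_imp_continuous_within)
next
  case (Suc k)
  then show ?case
    by (metis Ck_on.simps(2))
qed

lemma Ck_on_dir: "Ck_on (Suc k) U f \<Longrightarrow> Ck_on k U (dir f v)"
  by simp

lemma Ck_on_imp_continuous_on: "Ck_on k U f \<Longrightarrow> continuous_on U f"
proof (induction k)
  case (Suc k)
  then show ?case using Ck_on_SucD by blast
qed simp

lemma Ck_on_const: "open U \<Longrightarrow> Ck_on k U (\<lambda>x. c)"
proof (induction k arbitrary: c)
  case (Suc k)
  show ?case
    by (rule Ck_on_SucI'[where f' = "\<lambda>x v. 0"]) (use Suc in auto)
qed simp

lemma Ck_on_bounded_linear:
  assumes "open U" "bounded_linear h" "Ck_on k U f"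
  shows "Ck_on k U (\<lambda>x. h (f x))"
  using assms(3)
proof (induction k arbitrary: f)
  case 0
  then show ?case
    by (simp add: bounded_linear.continuous_on[OF assms(2)])
next
  case (Suc k)
  show ?case
    by (rule Ck_on_SucI'[where f' = "\<lambda>x v. h (dir f v x)"])
      (use Suc assms(1) bounded_linear.has_derivative[OF assms(2) Ck_on_has_derivative[OF Suc.prems]] in auto)
qed

lemma Ck_on_add:
  assumes "open U" "Ck_on k U f" "Ck_on k U g"
  shows "Ck_on k U (\<lambda>x. f x + g x)"
  using assms(2,3)
proof (induction k arbitrary: f g)
  case 0
  then show ?case by (simp add: continuous_on_add)
next
  case (Suc k)
  show ?case
    by (rule Ck_on_SucI'[where f' = "\<lambda>x v. dir f v x + dir g v x"])
      (use Suc assms(1) has_derivative_add[OF Suc.prems[THEN Ck_on_has_derivative]] in auto)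
qed

lemma Ck_on_bilinear:
  assumes "open U" "bounded_bilinear h" "Ck_on k U f" "Ck_on k U g"
  shows "Ck_on k U (\<lambda>x. h (f x) (g x))"
  using assms(3,4)
proof (induction k arbitrary: f g)
  case 0
  then show ?case
    by (simp add: bounded_bilinear.continuous_on[OF assms(2)])
next
  case (Suc k)
  show ?case
  proof (rule Ck_on_SucI'[where f' = "\<lambda>x v. h (f x) (dir g v x) + h (dir f v x) (g x)"])
    show "((\<lambda>x. h (f x) (g x)) has_derivative (\<lambda>v. h (f x) (dir g v x) + h (dir f v x) (g x))) (at x)"
      if "x \<in> U" for x
      by (rule bounded_bilinear.FDERIV[OF assms(2)]) (use that Suc.prems[THEN Ck_on_has_derivative] in auto)
    show "Ck_on k U (\<lambda>x. h (f x) (dir g v x) + h (dir f v x) (g x))" for v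
      by (intro Ck_on_add[OF \<open>open U\<close>] Suc.IH Ck_on_dir Suc.prems Ck_on_SucD[OF Suc.prems(1)] Ck_on_SucD[OF Suc.prems(2)])
  qed (use assms in auto)
qed

lemma Ck_on_mult:
  fixes f g :: "'a::real_normed_vector \<Rightarrow> 'b::real_normed_algebra"
  shows "open U \<Longrightarrow> Ck_on k U f \<Longrightarrow> Ck_on k U g \<Longrightarrow> Ck_on k U (\<lambda>x. f x * g x)"
  by (rule Ck_on_bilinear[OF _ bounded_bilinear_mult])

lemma Ck_on_uminus: "open U \<Longrightarrow> Ck_on k U f \<Longrightarrow> Ck_on k U (\<lambda>x. - f x)"
  by (rule Ck_on_bounded_linear[OF _ bounded_linear_minus[OF bounded_linear_ident]])

lemma Ck_on_diff: "open U \<Longrightarrow> Ck_on k U f \<Longrightarrow> Ck_on k U g \<Longrightarrow> Ck_on k U (\<lambda>x. f x - g x)"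
  using Ck_on_add[of U k f "\<lambda>x. - g x"] Ck_on_uminus[of U k g] by simp

lemma Ck_on_sum:
  "open U \<Longrightarrow> (\<And>i. i \<in> A \<Longrightarrow> Ck_on k U (f i)) \<Longrightarrow> Ck_on k U (\<lambda>x. \<Sum>i\<in>A. f i x)"
  by (induction A rule: infinite_finite_induct) (auto intro: Ck_on_const Ck_on_add)

lemma Ck_on_power:
  fixes f :: "'a::real_normed_vector \<Rightarrow> 'b::real_normed_algebra_1"
  shows "open U \<Longrightarrow> Ck_on k U f \<Longrightarrow> Ck_on k U (\<lambda>x. f x ^ n)"
  by (induction n) (auto intro: Ck_on_const Ck_on_mult)

lemma Ck_on_inverse:
  fixes f :: "'a::real_normed_vector \<Rightarrow> 'b::real_normed_field"
  assumes "open U" "Ck_on k U f" and nz: "\<And>x. x \<in> U \<Longrightarrow> f x \<noteq> 0"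
  shows "Ck_on k U (\<lambda>x. inverse (f x))"
  using assms(2)
proof (induction k)
  case 0
  then show ?case
    using nz by (auto intro: continuous_on_inverse)
next
  case (Suc k)
  show ?case
  proof (rule Ck_on_SucI'[where f' = "\<lambda>x v. - (inverse (f x) * dir f v x * inverse (f x))"])
    show "((\<lambda>x. inverse (f x)) has_derivative (\<lambda>v. - (inverse (f x) * dir f v x * inverse (f x)))) (at x)"
      if "x \<in> U" for x
      by (rule Deriv.has_derivative_inverse[OF nz[OF that] Ck_on_has_derivative[OF Suc.prems that]])
    show "Ck_on k U (\<lambda>x. - (inverse (f x) * dir f v x * inverse (f x)))" for v
      using Suc Ck_on_SucD[OF Suc.prems]
      by (intro Ck_on_uminus Ck_on_mult Ck_on_dir \<open>open U\<close>) auto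
  qed (use assms in auto)
qed

subsection \<open>Symmetry of second derivatives\<close>

lemma dir_along_line:
  assumes "(f has_derivative frechet_derivative f (at (x + s *\<^sub>R v))) (at (x + s *\<^sub>R v))"
  shows "((\<lambda>s. f (x + s *\<^sub>R v)) has_real_derivative dir f v (x + s *\<^sub>R v)) (at s within S)"
proof -
  have "((\<lambda>s. x + s *\<^sub>R v) has_derivative (\<lambda>h. h *\<^sub>R v)) (at s)"
    by (auto intro!: derivative_eq_intros)
  from has_derivative_compose[OF this assms] bounded_linear.linear[OF has_derivative_bounded_linear[OF assms]]
  show ?thesis
    by (simp add: has_field_derivative_def linear_scale has_derivative_at_withinI mult_commute_abs)
qed

text \<open>A second difference quotient is a value of the mixed second derivative at an intermediate
  point; the quotient is symmetric in the two directions.\<close>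

lemma second_difference_mvt:
  fixes f :: "'a::real_normed_vector \<Rightarrow> real"
  assumes f: "Ck_on 2 U f" and h: "h > 0"
    and U: "\<And>s t. 0 \<le> s \<Longrightarrow> s \<le> h \<Longrightarrow> 0 \<le> t \<Longrightarrow> t \<le> h \<Longrightarrow> x + s *\<^sub>R v + t *\<^sub>R w \<in> U"
  obtains s t where "0 \<le> s" "s \<le> h" "0 \<le> t" "t \<le> h"
    "f (x + h *\<^sub>R v + h *\<^sub>R w) - f (x + h *\<^sub>R v) - f (x + h *\<^sub>R w) + f x
      = h\<^sup>2 * dir (dir f v) w (x + s *\<^sub>R v + t *\<^sub>R w)"
proof -
  have f1: "Ck_on (Suc (Suc 0)) U f" using f by (simp only: numeral_2_eq_2)
  define g where "g = (\<lambda>s. f ((x + h *\<^sub>R w) + s *\<^sub>R v) - f (x + s *\<^sub>R v))"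
  have "\<exists>s>0. s < h \<and> g h - g 0 = (h - 0) * (dir f v ((x + h *\<^sub>R w) + s *\<^sub>R v) - dir f v (x + s *\<^sub>R v))"
  proof (rule MVT2[OF h])
    fix s assume s: "0 \<le> s" "s \<le> h"
    then have "(x + h *\<^sub>R w) + s *\<^sub>R v \<in> U" "x + s *\<^sub>R v \<in> U"
      using U[of s h] U[of s 0] h by (auto simp: algebra_simps)
    then show "(g has_real_derivative (dir f v ((x + h *\<^sub>R w) + s *\<^sub>R v) - dir f v (x + s *\<^sub>R v))) (at s)"
      unfolding g_def by (intro DERIV_diff dir_along_line Ck_on_has_derivative[OF f1])
  qed
  then obtain s where s: "0 < s" "s < h"
    and gs: "g h - g 0 = h * (dir f v ((x + s *\<^sub>R v) + h *\<^sub>R w) - dir f v ((x + s *\<^sub>R v) + 0 *\<^sub>R w))"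
    by (auto simp: algebra_simps)
  have "\<exists>t>0. t < h \<and> dir f v ((x + s *\<^sub>R v) + h *\<^sub>R w) - dir f v ((x + s *\<^sub>R v) + 0 *\<^sub>R w)
      = (h - 0) * dir (dir f v) w ((x + s *\<^sub>R v) + t *\<^sub>R w)"
  proof (rule MVT2[OF h])
    fix t assume t: "0 \<le> t" "t \<le> h"
    show "((\<lambda>t. dir f v ((x + s *\<^sub>R v) + t *\<^sub>R w)) has_real_derivative dir (dir f v) w ((x + s *\<^sub>R v) + t *\<^sub>R w)) (at t)"
      using s t by (intro dir_along_line Ck_on_has_derivative[OF Ck_on_dir[OF f1]] U) auto
  qed
  then obtain t where t: "0 < t" "t < h"
    and dt: "dir f v ((x + s *\<^sub>R v) + h *\<^sub>R w) - dir f v ((x + s *\<^sub>R v) + 0 *\<^sub>R w)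
      = h * dir (dir f v) w ((x + s *\<^sub>R v) + t *\<^sub>R w)"
    by auto
  show thesis
    by (rule that[of s t]) (use s t gs[unfolded dt] in \<open>auto simp: g_def power2_eq_square algebra_simps\<close>)
qed

text \<open>The second difference over a small parallelogram is expressed by either mixed derivative; both
  values tend to those at \<open>x\<close> by continuity.\<close>

lemma dir_dir_commute_real:
  fixes f :: "'a::real_normed_vector \<Rightarrow> real"
  assumes "open U" and f: "Ck_on 2 U f" and "x \<in> U"
  shows "dir (dir f v) w x = dir (dir f w) v x"
proof -
  have "dir (dir f v) w x - dir (dir f w) v x = 0"
  proof (rule dense_eq0_I)
  fix e :: real assume "0 < e"
  have f1: "Ck_on (Suc (Suc 0)) U f" using f by (simp only: numeral_2_eq_2)
  have near: "\<exists>d>0. \<forall>y. dist y x < d \<longrightarrow> y \<in> U \<and> \<bar>dir (dir f v) w y - dir (dir f v) w x\<bar> < e / 2" for v w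
  proof -
    have "continuous_on U (dir (dir f v) w)"
      using f1 by simp
    then have "isCont (dir (dir f v) w) x"
      using assms by (simp add: continuous_on_eq_continuous_at)
    then obtain d1 where d1: "d1 > 0" "\<And>y. dist y x < d1 \<Longrightarrow> \<bar>dir (dir f v) w y - dir (dir f v) w x\<bar> < e / 2"
      using \<open>0 < e\<close> unfolding continuous_at_eps_delta dist_real_def by (meson half_gt_zero)
    obtain d2 where d2: "d2 > 0" "\<And>y. dist y x < d2 \<Longrightarrow> y \<in> U"
      using assms unfolding open_dist by blast
    show ?thesis
      by (rule exI[of _ "min d1 d2"]) (use d1 d2 in auto)
  qed
  obtain d1 where d1: "d1 > 0" "\<And>y. dist y x < d1 \<Longrightarrow> y \<in> U \<and> \<bar>dir (dir f v) w y - dir (dir f v) w x\<bar> < e / 2"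
    using near[of v w] by blast
  obtain d2 where d2: "d2 > 0" "\<And>y. dist y x < d2 \<Longrightarrow> y \<in> U \<and> \<bar>dir (dir f w) v y - dir (dir f w) v x\<bar> < e / 2"
    using near[of w v] by blast
  define h where "h = min d1 d2 / (2 * (norm v + norm w + 1))"
  have pos: "2 * (norm v + norm w + 1) > 0"
    by (smt (verit) norm_ge_zero)
  have h: "h > 0"
    using d1 d2 pos by (simp add: h_def)
  have close: "dist (x + s *\<^sub>R v + t *\<^sub>R w) x < min d1 d2" if "0 \<le> s" "s \<le> h" "0 \<le> t" "t \<le> h" for s t
  proof -
    have "dist (x + s *\<^sub>R v + t *\<^sub>R w) x \<le> s * norm v + t * norm w"
      using that norm_triangle_ineq[of "s *\<^sub>R v" "t *\<^sub>R w"] by (simp add: dist_norm)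
    also have "\<dots> \<le> h * norm v + h * norm w"
      using that by (intro add_mono mult_right_mono) auto
    also have "\<dots> \<le> h * (norm v + norm w + 1)"
      using h by (simp add: algebra_simps)
    also have "\<dots> = min d1 d2 / 2"
      using pos by (simp add: h_def field_simps)
    also have "\<dots> < min d1 d2"
      using d1(1) d2(1) by (simp add: min_def)
    finally show ?thesis .
  qed
  obtain s t where st: "0 \<le> s" "s \<le> h" "0 \<le> t" "t \<le> h"
    and eq1: "f (x + h *\<^sub>R v + h *\<^sub>R w) - f (x + h *\<^sub>R v) - f (x + h *\<^sub>R w) + f x
      = h\<^sup>2 * dir (dir f v) w (x + s *\<^sub>R v + t *\<^sub>R w)"
    proof (rule second_difference_mvt[OF f h, of x v w])
    fix s t assume "0 \<le> s" "s \<le> h" "0 \<le> t" "t \<le> h"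
    then show "x + s *\<^sub>R v + t *\<^sub>R w \<in> U"
      using close[of s t] d1 by simp
  qed blast
  obtain s' t' where st': "0 \<le> s'" "s' \<le> h" "0 \<le> t'" "t' \<le> h"
    and eq2: "f (x + h *\<^sub>R w + h *\<^sub>R v) - f (x + h *\<^sub>R w) - f (x + h *\<^sub>R v) + f x
      = h\<^sup>2 * dir (dir f w) v (x + s' *\<^sub>R w + t' *\<^sub>R v)"
  proof (rule second_difference_mvt[OF f h, of x w v])
    fix s t assume "0 \<le> s" "s \<le> h" "0 \<le> t" "t \<le> h"
    then show "x + s *\<^sub>R w + t *\<^sub>R v \<in> U"
      using close[of t s] d2 by (simp add: add_ac)
  qed blast
  have "h\<^sup>2 * dir (dir f v) w (x + s *\<^sub>R v + t *\<^sub>R w) = h\<^sup>2 * dir (dir f w) v (x + s' *\<^sub>R w + t' *\<^sub>R v)"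
  proof -
    have swap: "x + h *\<^sub>R w + h *\<^sub>R v = x + h *\<^sub>R v + h *\<^sub>R w" by (simp add: add_ac)
    show ?thesis using eq1 eq2[unfolded swap] by linarith
  qed
  then have "dir (dir f v) w (x + s *\<^sub>R v + t *\<^sub>R w) = dir (dir f w) v (x + s' *\<^sub>R w + t' *\<^sub>R v)"
    using h by simp
  moreover have "\<bar>dir (dir f v) w (x + s *\<^sub>R v + t *\<^sub>R w) - dir (dir f v) w x\<bar> < e / 2"
    using d1(2)[of "x + s *\<^sub>R v + t *\<^sub>R w"] close[OF st] by simp
  moreover have "\<bar>dir (dir f w) v (x + s' *\<^sub>R w + t' *\<^sub>R v) - dir (dir f w) v x\<bar> < e / 2"
    using d2(2)[of "x + s' *\<^sub>R w + t' *\<^sub>R v"] close[OF st'(3,4,1,2)] by (simp add: add_ac)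
  ultimately show "\<bar>dir (dir f v) w x - dir (dir f w) v x\<bar> \<le> e"
    by linarith
  qed
  then show ?thesis by simp
qed

lemma dir_bounded_linear:
  assumes "bounded_linear h" and "(f has_derivative frechet_derivative f (at x)) (at x)"
  shows "dir (\<lambda>y. h (f y)) v x = h (dir f v x)"
  using fun_cong[OF frechet_derivative_at[OF bounded_linear.has_derivative[OF assms]], of v] by simp

lemma dir_cong:
  assumes "open U" "x \<in> U" "\<And>y. y \<in> U \<Longrightarrow> f y = g y" 
    and "(f has_derivative frechet_derivative f (at x)) (at x)"
  shows "dir g v x = dir f v x"
  using frechet_derivative_at[OF has_derivative_transform_within_open[OF assms(4) assms(1,2)], of g] assms(3)
  by simp

lemma dir_dir_bounded_linear:
  assumes "open U" "bounded_linear h" and f: "Ck_on 2 U f" and "x \<in> U"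
  shows "dir (dir (\<lambda>y. h (f y)) v) w x = h (dir (dir f v) w x)"
proof -
  have f1: "Ck_on (Suc (Suc 0)) U f" using f by (simp only: numeral_2_eq_2)
  have d: "(dir f v has_derivative frechet_derivative (dir f v) (at x)) (at x)"
    by (rule Ck_on_has_derivative[OF Ck_on_dir[OF f1] \<open>x \<in> U\<close>])
  have eq: "((\<lambda>y. h (dir f v y)) has_derivative (\<lambda>w. h (dir (dir f v) w x))) (at x)"
    using bounded_linear.has_derivative[OF assms(2) d] .
  have "(dir (\<lambda>y. h (f y)) v has_derivative (\<lambda>w. h (dir (dir f v) w x))) (at x)"
    by (rule has_derivative_transform_within_open[OF eq assms(1,4)])
      (simp add: dir_bounded_linear[OF assms(2) Ck_on_has_derivative[OF f1]])
  from fun_cong[OF frechet_derivative_at[OF this], of w] show ?thesis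
    by simp
qed

theorem dir_dir_commute:
  fixes f :: "'a::real_normed_vector \<Rightarrow> 'b::real_inner"
  assumes "open U" and f: "Ck_on 2 U f" and "x \<in> U"
  shows "dir (dir f v) w x = dir (dir f w) v x"
proof (rule vector_eq_rdot[THEN iffD1], rule allI)
  fix e
  have "inner (dir (dir f v) w x) e = dir (dir (\<lambda>y. inner (f y) e) v) w x"
    for v w
    by (rule dir_dir_bounded_linear[OF assms(1) bounded_linear_inner_left f \<open>x \<in> U\<close>, symmetric])
  then show "inner (dir (dir f v) w x) e = inner (dir (dir f w) v x) e"
    using dir_dir_commute_real[OF assms(1) Ck_on_bounded_linear[OF assms(1) bounded_linear_inner_left f] assms(3)]
    by simp
qed

lemma dir_eqI: "(f has_derivative f') (at x) \<Longrightarrow> dir f v x = f' v"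
  by (drule frechet_derivative_at) simp

lemma dir_dir_diff:
  assumes "open U" and f: "Ck_on 2 U f" and g: "Ck_on 2 U g" and x: "x \<in> U"
  shows "dir (\<lambda>y. f y - g y) v x = dir f v x - dir g v x"
    and "dir (dir (\<lambda>y. f y - g y) v) w x = dir (dir f v) w x - dir (dir g v) w x"
proof -
  have f1: "Ck_on (Suc (Suc 0)) U f" and g1: "Ck_on (Suc (Suc 0)) U g"
    using f g by (simp_all only: numeral_2_eq_2)
  have D: "dir (\<lambda>y. f y - g y) v y = dir f v y - dir g v y" if "y \<in> U" for y
    by (rule dir_eqI) (intro has_derivative_diff Ck_on_has_derivative[OF f1 that] Ck_on_has_derivative[OF g1 that])
  then show "dir (\<lambda>y. f y - g y) v x = dir f v x - dir g v x" using x .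
  have "((\<lambda>y. dir f v y - dir g v y) has_derivative (\<lambda>w. dir (dir f v) w x - dir (dir g v) w x)) (at x)"
    by (intro has_derivative_diff Ck_on_has_derivative[OF Ck_on_dir[OF f1] x] Ck_on_has_derivative[OF Ck_on_dir[OF g1] x])
  then have "(dir (\<lambda>y. f y - g y) v has_derivative (\<lambda>w. dir (dir f v) w x - dir (dir g v) w x)) (at x)"
    by (rule has_derivative_transform_within_open[OF _ assms(1) x]) (simp add: D)
  then show "dir (dir (\<lambda>y. f y - g y) v) w x = dir (dir f v) w x - dir (dir g v) w x"
    by (rule dir_eqI)
qed

lemma dir_dir_norm_square:
  fixes X :: "'e::real_normed_vector \<Rightarrow> 'v::real_inner"
  assumes U: "open U" and X: "Ck_on 2 U X" and x: "x \<in> U"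
  shows "dir (\<lambda>y. (norm (X y))\<^sup>2) v x = 2 * inner (dir X v x) (X x)"
    and "dir (dir (\<lambda>y. (norm (X y))\<^sup>2) v) v x = 2 * (norm (dir X v x))\<^sup>2 + 2 * inner (dir (dir X v) v x) (X x)"
proof -
  have X1: "Ck_on (Suc (Suc 0)) U X" using X by (simp only: numeral_2_eq_2)
  note dX = Ck_on_has_derivative[OF X1] and ddX = Ck_on_has_derivative[OF Ck_on_dir[OF X1]]
  have D: "dir (\<lambda>y. (norm (X y))\<^sup>2) v y = 2 * inner (dir X v y) (X y)" if "y \<in> U" for y
  proof -
    have "((\<lambda>y. inner (X y) (X y)) has_derivative (\<lambda>v. inner (X y) (dir X v y) + inner (dir X v y) (X y))) (at y)"
      by (intro has_derivative_inner dX that)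
    from dir_eqI[OF this, of v] show ?thesis
      by (simp add: power2_norm_eq_inner inner_commute)
  qed
  then show "dir (\<lambda>y. (norm (X y))\<^sup>2) v x = 2 * inner (dir X v x) (X x)" using x .
  have "((\<lambda>y. 2 * inner (dir X v y) (X y)) has_derivative
      (\<lambda>w. 2 * (inner (dir X v x) (dir X w x) + inner (dir (dir X v) w x) (X x)))) (at x)"
    by (intro has_derivative_mult_right has_derivative_inner dX ddX x)
  then have "(dir (\<lambda>y. (norm (X y))\<^sup>2) v has_derivative
      (\<lambda>w. 2 * (inner (dir X v x) (dir X w x) + inner (dir (dir X v) w x) (X x)))) (at x)"
    by (rule has_derivative_transform_within_open[OF _ U x]) (simp add: D)
  from dir_eqI[OF this, of v]
  show "dir (dir (\<lambda>y. (norm (X y))\<^sup>2) v) v x = 2 * (norm (dir X v x))\<^sup>2 + 2 * inner (dir (dir X v) v x) (X x)"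
    by (simp add: power2_norm_eq_inner)
qed

subsection \<open>Minima and curves\<close>

lemma interior_minimum_second_order:
  fixes f :: "'a::real_normed_vector \<Rightarrow> real"
  assumes "open U" and f: "Ck_on 2 U f" and x: "x \<in> U" and min: "\<And>y. y \<in> U \<Longrightarrow> f x \<le> f y"
  shows "dir f v x = 0" and "0 \<le> dir (dir f v) v x"
proof -
  have f1: "Ck_on (Suc (Suc 0)) U f" using f by (simp only: numeral_2_eq_2)
  define g where "g = (\<lambda>s. f (x + s *\<^sub>R v))"
  have "open ((\<lambda>s. x + s *\<^sub>R v) -` U)"
    by (intro open_vimage \<open>open U\<close> continuous_intros)
  then obtain d where d: "d > 0" "\<And>s. \<bar>s\<bar> < d \<Longrightarrow> x + s *\<^sub>R v \<in> U"
    using x unfolding open_dist by (auto simp: dist_real_def dest!: bspec[of _ _ 0])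
  have g1: "(g has_real_derivative dir f v (x + s *\<^sub>R v)) (at s)" if "\<bar>s\<bar> < d" for s
    unfolding g_def by (intro dir_along_line Ck_on_has_derivative[OF f1] d that)
  have "dir f v (x + 0 *\<^sub>R v) = 0"
    by (rule DERIV_local_min[OF g1[of 0] d(1)]) (use d min in \<open>auto simp: g_def\<close>)
  then show zero: "dir f v x = 0" by simp
  show "0 \<le> dir (dir f v) v x"
  proof (rule ccontr)
    assume "\<not> 0 \<le> dir (dir f v) v x"
    then have neg: "dir (dir f v) v (x + 0 *\<^sub>R v) < 0" by simp
    have "((\<lambda>s. dir f v (x + s *\<^sub>R v)) has_real_derivative dir (dir f v) v (x + 0 *\<^sub>R v)) (at 0)"
      using x by (intro dir_along_line Ck_on_has_derivative[OF Ck_on_dir[OF f1]]) auto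
    from DERIV_neg_dec_right[OF this neg] obtain e
      where e: "e > 0" "\<And>s. 0 < s \<Longrightarrow> s < e \<Longrightarrow> dir f v (x + s *\<^sub>R v) < 0"
      using zero by auto
    define r where "r = min d e / 2"
    have r: "0 < r" "r < d" "r < e"
      using d(1) e(1) by (auto simp: r_def)
    have "\<exists>s>0. s < r \<and> g r - g 0 = (r - 0) * dir f v (x + s *\<^sub>R v)"
      by (rule MVT2[OF r(1)]) (use r in \<open>auto intro: g1\<close>)
    then obtain s where "0 < s" "s < r" "g r - g 0 = r * dir f v (x + s *\<^sub>R v)"
      by auto
    then have "g r < g 0"
      using e(2)[of s] r by (smt (verit) mult_pos_neg)
    then show False
      using min[OF d(2)[of r]] r by (simp add: g_def)
  qed
qed

lemma dir_eq_sum_Basis: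
  fixes v :: "'a::euclidean_space"
  assumes "(f has_derivative frechet_derivative f (at x)) (at x)"
  shows "dir f v x = (\<Sum>b\<in>Basis. inner v b *\<^sub>R dir f b x)"
  using bounded_linear.linear[OF has_derivative_bounded_linear[OF assms]]
  by (subst euclidean_representation[of v, symmetric]) (simp only: linear_sum linear_scale)

lemma curve_first_derivative:
  fixes f :: "'a::real_normed_vector \<Rightarrow> real"
  assumes f: "(f has_derivative frechet_derivative f (at (c s))) (at (c s))"
    and c: "(c has_vector_derivative c') (at s within I)"
  shows "((\<lambda>s. f (c s)) has_real_derivative dir f c' (c s)) (at s within I)"
  using has_derivative_compose[OF c[unfolded has_vector_derivative_def] f]
    bounded_linear.linear[OF has_derivative_bounded_linear[OF f]]
  by (simp add: has_field_derivative_def linear_scale mult_commute_abs)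

text \<open>In a basis the derivative along the curve is a finite sum of products, so that differentiability
  of each directional derivative suffices. The time set may be any set, with one-sided derivatives at
  its end points.\<close>

lemma curve_second_derivative:
  fixes f :: "'a::euclidean_space \<Rightarrow> real"
  assumes f: "Ck_on 2 U f" and U: "open U" "c s \<in> U" and s: "s \<in> I"
    and c: "(c has_vector_derivative c' s) (at s within I)"
    and c': "(c' has_vector_derivative c'') (at s within I)"
  shows "((\<lambda>s. dir f (c' s) (c s)) has_real_derivative
            dir (dir f (c' s)) (c' s) (c s) + dir f c'' (c s)) (at s within I)"
proof -
  have f1: "Ck_on (Suc (Suc 0)) U f" using f by (simp only: numeral_2_eq_2)
  note df = Ck_on_has_derivative[OF f1]
  note ddf = Ck_on_has_derivative[OF Ck_on_dir[OF f1]]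
  let ?S = "\<lambda>s. \<Sum>b\<in>Basis. inner (c' s) b * dir f b (c s)"
  have cont: "((\<lambda>s. c s) \<longlongrightarrow> c s) (at s within I)"
    using has_vector_derivative_continuous[OF c] by (simp add: continuous_within)
  have ev: "\<forall>\<^sub>F t in at s within I. ?S t = dir f (c' t) (c t)"
    using topological_tendstoD[OF cont U]
    by eventually_elim (simp add: dir_eq_sum_Basis[OF df, of _ "c' _"])
  have "(?S has_real_derivative (\<Sum>b\<in>Basis. inner c'' b * dir f b (c s)
         + inner (c' s) b * dir (dir f b) (c' s) (c s))) (at s within I)"
  proof (rule DERIV_sum)
    fix b :: 'a
    have "((\<lambda>s. inner (c' s) b) has_real_derivative inner c'' b) (at s within I)"
      using bounded_linear.has_vector_derivative[OF bounded_linear_inner_left c']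
      by (simp add: has_real_derivative_iff_has_vector_derivative)
    from DERIV_mult[OF this curve_first_derivative[OF ddf c]] U(2)
    show "((\<lambda>s. inner (c' s) b * dir f b (c s)) has_real_derivative
      inner c'' b * dir f b (c s) + inner (c' s) b * dir (dir f b) (c' s) (c s)) (at s within I)"
      by (simp add: add.commute mult.commute)
  qed
  moreover have "(\<Sum>b\<in>Basis. inner c'' b * dir f b (c s)) = dir f c'' (c s)"
    by (simp add: dir_eq_sum_Basis[OF df[OF U(2)], of c''])
  moreover have "(\<Sum>b\<in>Basis. inner (c' s) b * dir (dir f b) (c' s) (c s)) = dir (dir f (c' s)) (c' s) (c s)"
    unfolding dir_eq_sum_Basis[OF ddf[OF U(2)], of "c' s" "c' s"]
    by (intro sum.cong refl) (simp add: dir_dir_commute[OF U(1) f U(2), of _ "c' s"])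
  ultimately show ?thesis
    using ev s U(2) unfolding has_field_derivative_def
    by (auto intro!: has_derivative_transform_eventually[of ?S] simp: sum.distrib add.commute dir_eq_sum_Basis[OF df, of _ "c' s"])
qed

section \<open>The spectral theorem\<close>

lemma (in hermitian_space) hm_sc_left: "hm (sc c x) y = c * hm x y"
proof (rule hm_eqI)
  fix d
  have "inner (sc c x) (sc d y) = inner (hm x y) (cconj c * d)"
    using inner_sc_left[of c x "sc d y"] by (simp add: sc_sc inner_hm)
  also have "\<dots> = inner (c * hm x y) d"
    using scalar_inner_mult_left[of c "hm x y" d] by simp
  finally show "inner (sc c x) (sc d y) = inner (c * hm x y) d" .
qed

lemma vec_hm: "vec_herm.hm x y = (\<Sum>i\<in>UNIV. x $ i * cconj (y $ i))" for x y :: "'k::rc_scalar^'m"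
proof (rule vec_herm.hm_eqI)
  fix c
  have "inner (x $ i) (c * y $ i) = inner (x $ i * cconj (y $ i)) c" for i
    using scalar_inner_mult_left[of "cconj (y $ i)" "x $ i" c] by (simp add: mult.commute)
  then show "inner x (c *s y) = inner (\<Sum>i\<in>UNIV. x $ i * cconj (y $ i)) c"
    by (simp add: inner_vec_def inner_sum_left)
qed

lemma adjoint_mat_adjoint_mat [simp]: "adjoint_mat (adjoint_mat M) = M"
  by (simp add: adjoint_mat_def vec_eq_iff)

lemma inner_mat_mult_left:
  "inner (M *v x) y = inner x (adjoint_mat M *v y)" for M :: "'k::rc_scalar^'m^'n"
proof -
  have "inner (M *v x) y = (\<Sum>i\<in>UNIV. \<Sum>j\<in>UNIV. inner (M $ i $ j * x $ j) (y $ i))"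
    by (simp add: inner_vec_def matrix_vector_mult_def inner_sum_left)
  also have "\<dots> = (\<Sum>j\<in>UNIV. \<Sum>i\<in>UNIV. inner (x $ j) (cconj (M $ i $ j) * y $ i))"
    by (subst sum.swap) (simp add: scalar_inner_mult_left)
  also have "\<dots> = inner x (adjoint_mat M *v y)"
    by (simp add: inner_vec_def matrix_vector_mult_def inner_sum_right adjoint_mat_def)
  finally show ?thesis .
qed

lemma linear_mat_vec: "linear ((*v) M)" for M :: "'k::rc_scalar^'m^'n"
proof (rule linearI)
  show "M *v (r *\<^sub>R x) = r *\<^sub>R (M *v x)" for r x
    by (simp add: matrix_vector_mult_def vec_eq_iff scaleR_sum_right)
qed (rule matrix_vector_right_distrib)

text \<open>A minimizer of the Rayleigh quotient is an eigenvector: the form shifted by its minimum is positive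
  semidefinite and vanishes at the minimizer, which therefore lies in its kernel.\<close>

lemma self_adjoint_has_eigenvector:
  fixes H :: "'v::euclidean_space \<Rightarrow> 'v"
  assumes H: "linear H" and sa: "\<And>x y. inner (H x) y = inner x (H y)"
    and S: "subspace S" and inv: "\<And>x. x \<in> S \<Longrightarrow> H x \<in> S" and z: "z \<in> S" "z \<noteq> 0"
  obtains x l where "x \<in> S" "norm x = 1" "H x = l *\<^sub>R x"
proof -
  have "compact (S \<inter> sphere 0 1)"
    by (intro closed_Int_compact closed_subspace S compact_sphere)
  moreover have "z /\<^sub>R norm z \<in> S \<inter> sphere 0 1"
    using z S by (auto simp: subspace_scale)
  moreover have "continuous_on (S \<inter> sphere 0 1) (\<lambda>x. inner (H x) x)"
    by (intro continuous_intros linear_continuous_on linear_conv_bounded_linear[THEN iffD1] H)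
  ultimately obtain x where x: "x \<in> S" "norm x = 1"
    and min: "\<And>y. y \<in> S \<Longrightarrow> norm y = 1 \<Longrightarrow> inner (H x) x \<le> inner (H y) y"
    using continuous_attains_inf[of "S \<inter> sphere 0 1" "\<lambda>x. inner (H x) x"] by fastforce
  define l where "l = inner (H x) x"
  define A where "A = (\<lambda>y. H y - l *\<^sub>R y)"
  have psd: "inner (A y) y \<ge> 0" if "y \<in> S" for y
  proof (cases "y = 0")
    case False
    have "l \<le> inner (H (y /\<^sub>R norm y)) (y /\<^sub>R norm y)"
      unfolding l_def using False that S by (intro min) (auto simp: subspace_scale)
    also have "\<dots> = inner (H y) y / (norm y)\<^sup>2"
      using H by (simp add: linear_scale power2_eq_square field_simps)
    finally show ?thesis
      using False by (simp add: A_def inner_diff_left field_simps power2_norm_eq_inner)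
  qed (simp add: A_def)
  have lin: "linear A"
    unfolding A_def using H by (intro linear_compose_sub linear_scaleR)
  have Asa: "inner (A u) v = inner u (A v)" for u v
    by (simp add: A_def inner_diff sa)
  have AxS: "A x \<in> S"
    unfolding A_def using x inv S by (intro subspace_diff subspace_scale) auto
  have zero: "inner (A x) x = 0"
    using x by (simp add: A_def inner_diff_left l_def power2_norm_eq_inner[symmetric])
  let ?p = "inner (A x) (A x)" and ?q = "inner (A (A x)) (A x)"
  \<comment> \<open>Semidefiniteness on the line through the minimizer in direction \<open>A x\<close>.\<close>
  have "- 2 * t * ?p + t\<^sup>2 * ?q \<ge> 0" for t
  proof -
    have "x - t *\<^sub>R A x \<in> S"
      using x AxS S by (intro subspace_diff subspace_scale)
    from psd[OF this] show ?thesis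
      using lin zero Asa[of "A x" x]
      by (simp add: linear_diff linear_scale inner_diff power2_eq_square algebra_simps inner_commute)
  qed
  \<comment> \<open>The quadratic is negative at this small positive argument unless \<open>?p = 0\<close>; adding one avoids a case distinction.\<close>
  moreover define t where "t = ?p / (?q + 1)"
  moreover have q: "?q \<ge> 0"
    using psd[OF AxS] .
  moreover have p: "?p = t * (?q + 1)"
    using q by (simp add: t_def)
  ultimately have "- 2 * t * (t * (?q + 1)) + t\<^sup>2 * ?q \<ge> 0"
    by metis
  then have "t\<^sup>2 * (?q + 2) \<le> 0"
    by (simp add: algebra_simps power2_eq_square)
  then have "t = 0"
    using q by (smt (verit) mult_pos_pos zero_less_power2)
  then have "?p = 0"
    using p by simp
  then have "H x = l *\<^sub>R x"
    by (simp add: A_def)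
  with x show thesis by (rule that)
qed

text \<open>A vector outside the span, minus its orthogonal projection.\<close>

lemma vec_orthonormal_extend:
  fixes B :: "('k::rc_scalar^'n) set"
  assumes B: "finite B" "card B < CARD('n)" and norm1: "\<And>b. b \<in> B \<Longrightarrow> norm b = 1"
    and orth: "\<And>b b'. b \<in> B \<Longrightarrow> b' \<in> B \<Longrightarrow> b \<noteq> b' \<Longrightarrow> vec_herm.hm b b' = 0"
  obtains z where "z \<noteq> 0" "\<And>b. b \<in> B \<Longrightarrow> vec_herm.hm z b = 0"
proof -
  have "vec.dim (vec.span B) \<le> card B"
    using B by (intro vec.dim_le_card) auto
  then have "vec.span B \<noteq> UNIV"
    using B vec_dim_card[where 'a='k and 'n='n] by (metis not_less)
  then obtain x where x: "x \<notin> vec.span B" by auto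
  define y where "y = x - (\<Sum>b\<in>B. vec_herm.hm x b *s b)"
  have "(\<Sum>b\<in>B. vec_herm.hm x b *s b) \<in> vec.span B"
    by (intro vec.span_sum vec.span_scale vec.span_base)
  then have "y \<noteq> 0" using x by (auto simp: y_def)
  moreover have "vec_herm.hm y b = 0" if b: "b \<in> B" for b
  proof -
    have "(\<Sum>b'\<in>B. vec_herm.hm x b' * vec_herm.hm b' b) = (\<Sum>b'\<in>B. if b' = b then vec_herm.hm x b else 0)"
      using orth[OF _ b] norm1[OF b] by (intro sum.cong) (auto simp: vec_herm.hm_self)
    then show ?thesis
      using B b by (simp add: y_def vec_herm.hm.diff_left vec_herm.hm.sum_left vec_herm.hm_sc_left)
  qed
  ultimately show thesis by (rule that)
qed

text \<open>Orthogonal complements of sets of eigenvectors are invariant, so eigenvectors can be found one by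
  one until the dimension is exhausted.\<close>

lemma hermitian_eigenbasis:
  fixes H :: "'k::rc_scalar^'n^'n"
  assumes H: "adjoint_mat H = H"
  obtains u :: "'n \<Rightarrow> 'k^'n" and d :: "'n \<Rightarrow> real"
  where "\<And>i j. vec_herm.hm (u i) (u j) = (if i = j then 1 else 0)" "\<And>i. H *v u i = d i *\<^sub>R u i"
proof -
  have sa: "inner (H *v x) y = inner x (H *v y)" for x y
    using inner_mat_mult_left[of H x y] H by simp
  have hsa: "vec_herm.hm (H *v x) y = vec_herm.hm x (H *v y)" for x y
  proof (rule vec_herm.hm_eqI)
    fix c
    show "inner (H *v x) (c *s y) = inner (vec_herm.hm x (H *v y)) c"
      by (simp add: sa vec_herm.inner_hm vector_scalar_commute)
  qed
  have lin: "linear ((*v) H)"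
    by (rule linear_mat_vec)
  have "k \<le> CARD('n) \<Longrightarrow> \<exists>B. finite B \<and> card B = k \<and> (\<forall>b\<in>B. norm b = 1 \<and> (\<exists>l::real. H *v b = l *\<^sub>R b)) \<and>
     (\<forall>b\<in>B. \<forall>b'\<in>B. b \<noteq> b' \<longrightarrow> vec_herm.hm b b' = 0)" for k
  proof (induction k)
    case 0
    show ?case by (rule exI[of _ "{}"]) auto
  next
    case (Suc k)
    then obtain B where B: "finite B" "card B = k" and nb: "\<And>b. b \<in> B \<Longrightarrow> norm b = 1"
      and eb: "\<And>b. b \<in> B \<Longrightarrow> \<exists>l::real. H *v b = l *\<^sub>R b"
      and ob: "\<And>b b'. b \<in> B \<Longrightarrow> b' \<in> B \<Longrightarrow> b \<noteq> b' \<Longrightarrow> vec_herm.hm b b' = 0"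
      by (auto simp: Suc_le_eq)
    define S where "S = {x. \<forall>b\<in>B. vec_herm.hm x b = 0}"
    have S: "subspace S"
      by (auto simp: S_def subspace_def vec_herm.hm.zero_left vec_herm.hm.add_left vec_herm.hm.scaleR_left)
    have inv: "H *v x \<in> S" if "x \<in> S" for x
      using that eb by (fastforce simp: S_def hsa vec_herm.hm.scaleR_right)
    have card: "card B < CARD('n)"
      using B(2) Suc.prems by simp
    obtain z where "z \<noteq> 0" "\<And>b. b \<in> B \<Longrightarrow> vec_herm.hm z b = 0"
      using vec_orthonormal_extend[OF B(1) card nb ob] by blast
    then have "z \<noteq> 0" "z \<in> S"
      by (simp_all add: S_def)
    then obtain x l where x: "x \<in> S" "norm x = 1" "H *v x = l *\<^sub>R x"
      using self_adjoint_has_eigenvector[OF lin sa S inv, of z] by blast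
    have "x \<notin> B"
      using x vec_herm.hm_self[of x] by (auto simp: S_def)
    moreover have "vec_herm.hm b x = 0" if "b \<in> B" for b
      using x(1) that vec_herm.hm_commute[of b x] by (simp add: S_def)
    ultimately show ?case
      using B x nb eb ob by (intro exI[of _ "insert x B"]) (auto simp: S_def)
  qed
  from this[OF order.refl] obtain B where B: "finite B" "card B = CARD('n)"
    and nb: "\<And>b. b \<in> B \<Longrightarrow> norm b = 1" and eb: "\<And>b. b \<in> B \<Longrightarrow> \<exists>l::real. H *v b = l *\<^sub>R b"
    and ob: "\<And>b b'. b \<in> B \<Longrightarrow> b' \<in> B \<Longrightarrow> b \<noteq> b' \<Longrightarrow> vec_herm.hm b b' = 0"
    by auto
  obtain u where u: "bij_betw u (UNIV :: 'n set) B"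
    using B finite_same_card_bij[of "UNIV :: 'n set" B] by auto
  have uB: "u i \<in> B" for i using u by (auto simp: bij_betw_def)
  have "u i \<noteq> u j" if "i \<noteq> j" for i j using u that by (auto simp: bij_betw_def inj_on_def)
  then have "vec_herm.hm (u i) (u j) = (if i = j then 1 else 0)" for i j
    using ob[OF uB uB] nb[OF uB] by (auto simp: vec_herm.hm_self)
  moreover from eb[OF uB] obtain d where "\<And>i. H *v u i = d i *\<^sub>R u i" by metis
  ultimately show thesis by (rule that)
qed

text \<open>The conjugation is carried out on matrices of polynomials, where \<open>P\<close> has a nonzero determinant that
  cancels.\<close>

lemma charpoly_eq_if_similar:
  fixes H D P Q :: "'k::field^'n^'n"
  assumes inv: "Q ** P = mat 1" and sim: "H ** P = P ** D"
  shows "charpoly H = charpoly D"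
proof -
  define pm :: "'k^'n^'n \<Rightarrow> 'k poly^'n^'n" where "pm A = (\<chi> i j. [:A $ i $ j:])" for A
  define C where "C A = (\<chi> i j. if i = j then [:- (A $ i $ j), 1:] else [:- (A $ i $ j):])" for A :: "'k^'n^'n"
  have const_sum: "(\<Sum>k\<in>UNIV. [:a k:]) = [:\<Sum>k\<in>UNIV. a k:]" for a :: "'n \<Rightarrow> 'k"
    by (intro poly_eqI) (simp add: coeff_sum coeff_pCons split: nat.split)
  have pm_mult: "pm A ** pm B = pm (A ** B)" for A B
    by (simp add: pm_def matrix_matrix_mult_def vec_eq_iff const_sum[symmetric] mult.commute)
  have X: "(\<Sum>k\<in>UNIV. (if i = k then [:a k, 1:] else [:a k:]) * b k)
     = (\<Sum>k\<in>UNIV. [:a k:] * b k) + [:0,1:] * b i" for a :: "'n \<Rightarrow> 'k" and b and i :: 'n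
  proof -
    have "(\<Sum>k\<in>UNIV. (if i = k then [:a k, 1:] else [:a k:]) * b k)
       = (\<Sum>k\<in>UNIV. [:a k:] * b k + (if k = i then [:0,1:] * b k else 0))"
      by (intro sum.cong refl) (auto simp: algebra_simps)
    then show ?thesis by (simp add: sum.distrib)
  qed
  have "C H ** pm P = pm P ** C D"
  proof -
    have "(C H ** pm P) $ i $ j = (pm P ** C D) $ i $ j" for i j
    proof -
      have "(C H ** pm P) $ i $ j = (\<Sum>k\<in>UNIV. (if i = k then [:- (H $ i $ k), 1:] else [:- (H $ i $ k):]) * [:P $ k $ j:])"
        by (simp add: matrix_matrix_mult_def C_def pm_def)
      also have "\<dots> = [:- ((H ** P) $ i $ j):] + [:0, 1:] * [:P $ i $ j:]"
        unfolding X by (simp add: const_sum matrix_matrix_mult_def sum_negf mult.commute)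
      also have "\<dots> = [:- ((P ** D) $ i $ j):] + [:0, 1:] * [:P $ i $ j:]"
        by (simp add: sim)
      also have "\<dots> = (\<Sum>k\<in>UNIV. (if j = k then [:- (D $ k $ j), 1:] else [:- (D $ k $ j):]) * [:P $ i $ k:])"
        unfolding X by (simp add: const_sum matrix_matrix_mult_def sum_negf mult.commute)
      also have "\<dots> = (pm P ** C D) $ i $ j"
        by (simp add: matrix_matrix_mult_def C_def pm_def mult.commute eq_commute[of j])
      finally show ?thesis .
    qed
    then show ?thesis by (simp add: vec_eq_iff)
  qed
  then have "det (C H) * det (pm P) = det (pm P) * det (C D)"
    by (metis det_mul)
  moreover have "det (pm Q) * det (pm P) = 1"
  proof -
    have "pm (mat 1) = mat 1"
      by (auto simp: pm_def mat_def vec_eq_iff one_pCons)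
    then show ?thesis by (metis det_mul pm_mult inv det_I)
  qed
  ultimately have "det (C H) = det (C D)"
    by (cases "det (pm P) = 0") (auto simp: mult.commute)
  then show ?thesis
    by (simp add: charpoly_def C_def)
qed

lemma charpoly_diagonal:
  "charpoly (\<chi> i j. if i = j then a i else (0 :: 'k::field)) = (\<Prod>i\<in>UNIV. [:- a i, 1:])"
  unfolding charpoly_def by (subst det_diagonal) auto

text \<open>Unitary diagonalization, with the Rayleigh quotient expressed in the eigenbasis.\<close>

theorem hermitian_spectral:
  fixes H :: "'k::rc_scalar^'n^'n"
  assumes H: "adjoint_mat H = H"
  obtains u :: "'n \<Rightarrow> 'k^'n" and d :: "'n \<Rightarrow> real"
  where "\<And>i. norm (u i) = 1" "\<And>i. H *v u i = d i *\<^sub>R u i"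
    "charpoly H = (\<Prod>i\<in>UNIV. [:- of_real (d i), 1:])"
    "\<And>x l. (\<And>i. l \<le> d i) \<Longrightarrow> l * (norm x)\<^sup>2 \<le> inner (H *v x) x"
proof -
  obtain u :: "'n \<Rightarrow> 'k^'n" and d :: "'n \<Rightarrow> real"
  where u: "\<And>i j. vec_herm.hm (u i) (u j) = (if i = j then 1 else 0)"
    and ev: "\<And>i. H *v u i = d i *\<^sub>R u i"
    using hermitian_eigenbasis[OF H] by metis
  define P where "P = (\<chi> i j. u j $ i)"
  define D where "D = (\<chi> i j. if i = j then of_real (d i) else (0 :: 'k))"
  have QP: "adjoint_mat P ** P = mat 1"
    using u by (auto simp: P_def adjoint_mat_def matrix_matrix_mult_def mat_def vec_eq_iff vec_hm mult.commute)
  then have PQ: "P ** adjoint_mat P = mat 1"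
    by (simp add: matrix_left_right_inverse)
  have HP: "H ** P = P ** D"
  proof -
    have "(H ** P) $ i $ j = (P ** D) $ i $ j" for i j
    proof -
      have "(H ** P) $ i $ j = (H *v u j) $ i"
        by (simp add: matrix_matrix_mult_def matrix_vector_mult_def P_def)
      also have "\<dots> = (P ** D) $ i $ j"
        by (simp add: ev matrix_matrix_mult_def P_def D_def if_distrib cong: if_cong)
          (simp add: scaleR_conv_of_real mult.commute)
      finally show ?thesis .
    qed
    then show ?thesis by (simp add: vec_eq_iff)
  qed
  have "charpoly H = (\<Prod>i\<in>UNIV. [:- of_real (d i), 1:])"
    using charpoly_eq_if_similar[OF QP HP] by (simp add: D_def charpoly_diagonal)
  moreover have "norm (u i) = 1" for i
    using u[of i i] vec_herm.inner_hm_one[of "u i" "u i"] by (simp add: norm_eq_sqrt_inner)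
  moreover have "l * (norm x)\<^sup>2 \<le> inner (H *v x) x" if l: "\<And>i. l \<le> d i" for l x
  proof -
    define w where "w = adjoint_mat P *v x"
    have x: "x = P *v w"
      by (simp add: w_def matrix_vector_mul_assoc PQ)
    have "(norm x)\<^sup>2 = (norm w)\<^sup>2"
      using inner_mat_mult_left[of P w x] by (simp add: power2_norm_eq_inner flip: x w_def)
    then have "l * (norm x)\<^sup>2 = (\<Sum>i\<in>UNIV. l * (norm (w $ i))\<^sup>2)"
      by (simp add: power2_norm_eq_inner inner_vec_def sum_distrib_left)
    also have "\<dots> \<le> (\<Sum>i\<in>UNIV. d i * (norm (w $ i))\<^sup>2)"
      by (intro sum_mono mult_right_mono l) auto
    also have "\<dots> = inner (D *v w) w"
      by (simp add: inner_vec_def matrix_vector_mult_def D_def if_distrib[of "\<lambda>c. c * _"] cong: if_cong)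
        (simp add: power2_norm_eq_inner flip: scaleR_conv_of_real)
    also have "\<dots> = inner (P *v (D *v w)) x"
      by (simp add: inner_mat_mult_left w_def)
    also have "P *v (D *v w) = H *v x"
      by (simp add: x matrix_vector_mul_assoc HP)
    finally show ?thesis .
  qed
  ultimately show thesis using ev that[of u d] by blast
qed

section \<open>The smallest singular value\<close>

text \<open>The rank-one matrix \<open>u y\<^sup>*\<close>.\<close>

definition outer :: "'k::rc_scalar^'n \<Rightarrow> 'k^'m \<Rightarrow> 'k^'m^'n" where
  "outer u y = (\<chi> i j. u $ i * cconj (y $ j))"

text \<open>The rank-one matrix represents the linear functional \<open>A \<mapsto> \<langle>A\<^sup>* u, y\<rangle>\<close>; this is what turns derivatives
  of \<open>\<parallel>M\<^sup>* u\<parallel>\<^sup>2\<close> into inner products with a fixed matrix.\<close>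

lemma inner_adjoint_mult: "inner (adjoint_mat A *v u) y = inner A (outer u y)"
  for A :: "'k::rc_scalar^'m^'n"
proof -
  have "inner (adjoint_mat A *v u) y = (\<Sum>j\<in>UNIV. \<Sum>i\<in>UNIV. inner (cconj (A $ i $ j) * u $ i) (y $ j))"
    by (simp add: inner_vec_def matrix_vector_mult_def inner_sum_left adjoint_mat_def)
  also have "\<dots> = (\<Sum>j\<in>UNIV. \<Sum>i\<in>UNIV. inner (A $ i $ j) (u $ i * cconj (y $ j)))"
  proof (intro sum.cong refl)
    fix i j
    have "inner (cconj (A $ i $ j) * u $ i) (y $ j) = inner (u $ i) (A $ i $ j * y $ j)"
      by (simp add: scalar_inner_mult_left)
    also have "\<dots> = inner (A $ i $ j * y $ j) (u $ i)"
      by (rule inner_commute)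
    also have "\<dots> = inner (A $ i $ j) (u $ i * cconj (y $ j))"
      using scalar_inner_mult_left[of "y $ j" "A $ i $ j" "u $ i"] by (simp add: mult.commute)
    finally show "inner (cconj (A $ i $ j) * u $ i) (y $ j) = inner (A $ i $ j) (u $ i * cconj (y $ j))" .
  qed
  also have "\<dots> = inner A (outer u y)"
    by (subst sum.swap) (simp add: inner_vec_def outer_def)
  finally show ?thesis .
qed

lemma adjoint_outer_mult: "adjoint_mat (outer u y) *v u = (norm u)\<^sup>2 *\<^sub>R y"
  for u :: "'k::rc_scalar^'n"
proof -
  have "(\<Sum>i\<in>UNIV. cconj (u $ i) * u $ i) = of_real ((norm u)\<^sup>2)"
    using vec_herm.hm_self[of u] by (simp add: vec_hm mult.commute)
  then have "(\<Sum>i\<in>UNIV. cconj (u $ i * cconj (y $ j)) * u $ i) = (norm u)\<^sup>2 *\<^sub>R y $ j" for j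
    by (simp add: cconj_mult mult.assoc mult.left_commute[of _ "y $ j"] flip: sum_distrib_left)
      (simp add: scaleR_conv_of_real mult.commute)
  then show ?thesis
    by (simp add: adjoint_mat_def outer_def matrix_vector_mult_def vec_eq_iff)
qed

lemma norm_outer: "norm (outer u y) = norm u * norm y"
proof -
  have "(norm (outer u y))\<^sup>2 = (norm u * norm y)\<^sup>2"
    using inner_adjoint_mult[of "outer u y" u y]
    by (simp add: adjoint_outer_mult power2_norm_eq_inner power_mult_distrib)
  then show ?thesis
    by (simp add: power2_eq_iff_nonneg)
qed

lemma norm_adjoint_mult_le: "norm (adjoint_mat A *v u) \<le> norm A * norm u"
proof -
  let ?y = "adjoint_mat A *v u"
  have "(norm ?y)\<^sup>2 = inner A (outer u ?y)"
    by (simp add: power2_norm_eq_inner inner_adjoint_mult)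
  also have "\<dots> \<le> norm A * (norm u * norm ?y)"
    using norm_cauchy_schwarz[of A "outer u ?y"] by (simp add: norm_outer)
  finally show ?thesis
    by (cases "?y = 0") (simp_all add: power2_eq_square)
qed

lemma bounded_linear_adjoint_mult: "bounded_linear (\<lambda>A :: 'k::rc_scalar^'m^'n. adjoint_mat A *v u)"
proof (rule bounded_linear_intro[of _ "norm u"])
  show "adjoint_mat (A + B) *v u = adjoint_mat A *v u + adjoint_mat B *v u" for A B :: "'k^'m^'n"
    by (simp add: adjoint_mat_def matrix_vector_mult_def vec_eq_iff cconj_add distrib_right sum.distrib)
  show "adjoint_mat (r *\<^sub>R A) *v u = r *\<^sub>R (adjoint_mat A *v u)" for r and A :: "'k^'m^'n"
    by (simp add: adjoint_mat_def matrix_vector_mult_def vec_eq_iff cconj_scaleR scaleR_sum_right)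
qed (rule norm_adjoint_mult_le)

lemma adjoint_mat_scale_mult: "adjoint_mat (mat_scale c A) *v u = cconj c *s (adjoint_mat A *v u)"
  by (simp add: adjoint_mat_def mat_scale_def matrix_vector_mult_def vec_eq_iff cconj_mult
      sum_distrib_left mult.assoc)

lemma gram_self_adjoint: "adjoint_mat (M ** adjoint_mat M) = M ** adjoint_mat (M :: 'k::rc_scalar^'m^'n)"
  by (simp add: adjoint_mat_def matrix_matrix_mult_def vec_eq_iff cconj_sum cconj_mult mult.commute)

lemma inner_gram: "inner ((M ** adjoint_mat M) *v u) u = (norm (adjoint_mat M *v u))\<^sup>2"
  by (simp add: matrix_vector_mul_assoc[symmetric] inner_mat_mult_left power2_norm_eq_inner)

text \<open>A strict gap between the first two entries of the sorted list says that the least value is taken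
  only once.\<close>

lemma sorted_list_first_two:
  fixes g :: "'n::finite \<Rightarrow> 'a::linorder"
  defines "xs \<equiv> sorted_list_of_multiset (image_mset g (mset_set UNIV))"
  obtains i where "xs ! 0 = g i" "\<And>j. xs ! 0 \<le> g j" "length xs = CARD('n)"
    "\<And>j. CARD('n) \<ge> 2 \<Longrightarrow> xs ! 0 < xs ! 1 \<Longrightarrow> j \<noteq> i \<Longrightarrow> g i < g j"
proof -
  have m: "mset xs = image_mset g (mset_set UNIV)" and s: "sorted xs"
    by (simp_all add: xs_def)
  have len: "length xs = CARD('n)"
    using arg_cong[OF m, of size] by simp
  have set: "set xs = range g"
    by (simp add: xs_def)
  have "xs ! 0 \<in> range g"
    using len by (simp flip: set)
  then obtain i where i: "xs ! 0 = g i" by auto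
  have le: "xs ! 0 \<le> g j" for j
  proof -
    have "g j \<in> set xs" by (simp add: set)
    then obtain k where "k < length xs" "xs ! k = g j" by (auto simp: in_set_conv_nth)
    then show ?thesis using sorted_nth_mono[OF s, of 0 k] by simp
  qed
  have "g i < g j" if n: "CARD('n) \<ge> 2" and lt: "xs ! 0 < xs ! 1" and j: "j \<noteq> i" for j
  proof (rule ccontr)
    assume "\<not> g i < g j"
    then have eq: "g j = g i" using le[of j] i by simp
    obtain a b ys where xs: "xs = a # b # ys"
      using len n by (metis (no_types) One_nat_def Suc_1 Suc_le_length_iff)
    have a: "a = g i" using i xs by simp
    have "y > a" if "y \<in> set (b # ys)" for y
      using that s lt by (auto simp: xs)
    then have "a \<notin># mset (b # ys)" by auto
    moreover have "mset xs = {#g i#} + image_mset g (mset_set (UNIV - {i}))"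
      unfolding m by (subst mset_set.remove[of UNIV i]) auto
    then have "mset (b # ys) = image_mset g (mset_set (UNIV - {i}))"
      by (simp add: xs a)
    moreover have "g j \<in># image_mset g (mset_set (UNIV - {i}))"
      using j by auto
    ultimately show False using eq a by metis
  qed
  with i le len show thesis by (rule that)
qed

lemma poly_pderiv_prod_linear:
  fixes a :: "'i::finite \<Rightarrow> 'a::{idom,semiring_char_0}"
  shows "poly (pderiv (\<Prod>j\<in>UNIV. [:- a j, 1:])) (a i) = (\<Prod>j\<in>UNIV - {i}. a i - a j)"
proof -
  define R where "R = (\<Prod>j\<in>UNIV - {i}. [:- a j, 1:])"
  have "(\<Prod>j\<in>UNIV. [:- a j, 1:]) = [:- a i, 1:] * R"
    unfolding R_def by (rule prod.remove) auto
  then have "poly (pderiv (\<Prod>j\<in>UNIV. [:- a j, 1:])) (a i) = poly R (a i)"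
    by (simp add: pderiv_mult pderiv_pCons del: mult_pCons_left)
  then show ?thesis
    by (simp add: R_def poly_prod)
qed

text \<open>The positional definition in terms of the sorted list of roots is translated into a variational one
  (least value of \<open>\<parallel>M\<^sup>* u\<parallel>\<^sup>2\<close>) and an algebraic one (root of the characteristic polynomial). The gap to
  the next singular value, if there is one, makes the root simple.\<close>

theorem smallest_singular_value:
  fixes M :: "'k::rc_scalar^'m^'n"
  defines "s \<equiv> sigma CARD('n) M" and "p \<equiv> charpoly (M ** adjoint_mat M)"
  shows "0 \<le> s" and "s\<^sup>2 * (norm u)\<^sup>2 \<le> (norm (adjoint_mat M *v u))\<^sup>2"
    and "\<exists>u. norm u = 1 \<and> (norm (adjoint_mat M *v u))\<^sup>2 = s\<^sup>2"
    and "poly p (of_real (s\<^sup>2)) = 0" and "degree p \<le> CARD('n)"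
    and "(CARD('n) \<ge> 2 \<longrightarrow> sigma (CARD('n) - 1) M > s) \<Longrightarrow> poly (pderiv p) (of_real (s\<^sup>2)) \<noteq> 0"
proof -
  let ?H = "M ** adjoint_mat M"
  obtain v :: "'n \<Rightarrow> 'k^'n" and d :: "'n \<Rightarrow> real"
    where v: "\<And>i. norm (v i) = 1" and ev: "\<And>i. ?H *v v i = d i *\<^sub>R v i"
    and cp: "p = (\<Prod>i\<in>UNIV. [:- of_real (d i), 1:])"
    and rayleigh: "\<And>x l. (\<And>i. l \<le> d i) \<Longrightarrow> l * (norm x)\<^sup>2 \<le> inner (?H *v x) x"
    unfolding p_def using hermitian_spectral[OF gram_self_adjoint[of M]] by metis
  have d: "d i = (norm (adjoint_mat M *v v i))\<^sup>2" for i
    using inner_gram[of M "v i"] v[of i] by (simp add: ev power2_norm_eq_inner[symmetric])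
  then have d0: "d i \<ge> 0" for i by simp
  define g where "g i = sqrt (d i)" for i
  have "proots p = image_mset (\<lambda>i. of_real (d i)) (mset_set UNIV)"
    unfolding cp by (subst proots_prod) (auto simp: sum_unfold_sum_mset)
  then have "image_mset (\<lambda>c. sqrt (norm c)) (proots p) = image_mset g (mset_set UNIV)"
    using d0 by (simp add: g_def[abs_def] multiset.map_comp o_def)
  define xs where "xs = sorted_list_of_multiset (image_mset g (mset_set UNIV))"
  have sv: "singular_values M = rev xs"
    using \<open>image_mset _ (proots p) = _\<close> by (simp add: singular_values_def xs_def flip: p_def)
  obtain i where i: "xs ! 0 = g i" "\<And>j. xs ! 0 \<le> g j" "length xs = CARD('n)"
    and uniq: "\<And>j. CARD('n) \<ge> 2 \<Longrightarrow> xs ! 0 < xs ! 1 \<Longrightarrow> j \<noteq> i \<Longrightarrow> g i < g j"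
    using sorted_list_first_two[of g] unfolding xs_def by metis
  have s: "s = xs ! 0"
    using i(3) by (simp add: s_def sigma_def sv rev_nth)
  have s2: "s\<^sup>2 = d i"
    using d0 by (simp add: s i g_def)
  show "0 \<le> s"
    using d0 by (simp add: s i g_def)
  have "s\<^sup>2 \<le> d j" for j
    using i(2)[of j] by (simp add: i(1) s2 g_def)
  then show "s\<^sup>2 * (norm u)\<^sup>2 \<le> (norm (adjoint_mat M *v u))\<^sup>2"
    using rayleigh[of "s\<^sup>2" u] by (simp add: inner_gram)
  show "\<exists>u. norm u = 1 \<and> (norm (adjoint_mat M *v u))\<^sup>2 = s\<^sup>2"
    using v d s2 by metis
  show "poly p (of_real (s\<^sup>2)) = 0"
    by (auto simp: cp poly_prod s2)
  show "degree p \<le> CARD('n)"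
    unfolding cp using degree_prod_sum_le[of UNIV "\<lambda>i. [:- of_real (d i), 1 :: 'k:]"] by simp
  show "poly (pderiv p) (of_real (s\<^sup>2)) \<noteq> 0"
    if simple: "CARD('n) \<ge> 2 \<longrightarrow> sigma (CARD('n) - 1) M > s"
  proof -
    have lt: "d i < d j" if "j \<noteq> i" for j
    proof -
      have "card {i, j} \<le> CARD('n)"
        by (rule card_mono) auto
      then have n: "CARD('n) \<ge> 2" using that by simp
      then have "sigma (CARD('n) - 1) M = xs ! 1"
        using i(3) by (simp add: sigma_def sv rev_nth Suc_diff_Suc numeral_2_eq_2)
      then have "g i < g j"
        using uniq[OF n _ that] simple n s by simp
      then show ?thesis by (simp add: g_def)
    qed
    have "poly (pderiv p) (of_real (s\<^sup>2)) = (\<Prod>j\<in>UNIV - {i}. of_real (d i) - of_real (d j))"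
      using poly_pderiv_prod_linear[of "\<lambda>j. of_real (d j) :: 'k" i] by (simp add: cp s2)
    moreover have "d i \<noteq> d j" if "j \<noteq> i" for j
      using lt[OF that] by simp
    then have "(\<Prod>j\<in>UNIV - {i}. of_real (d i) - of_real (d j)) \<noteq> (0 :: 'k)"
      by (auto simp flip: of_real_diff)
    ultimately show ?thesis
      by simp
  qed
qed

lemma smallest_singular_value_unique:
  fixes M :: "'k::rc_scalar^'m^'n"
  assumes "\<And>u. norm u = 1 \<Longrightarrow> r \<le> (norm (adjoint_mat M *v u))\<^sup>2"
    and "norm w = 1" "(norm (adjoint_mat M *v w))\<^sup>2 = r"
  shows "(sigma CARD('n) M)\<^sup>2 = r"
  using smallest_singular_value(2)[of M w] smallest_singular_value(3)[of M] assms
  by (metis antisym mult.right_neutral one_power2)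

lemma smallest_singular_value_scale:
  fixes M :: "'k::rc_scalar^'m^'n"
  shows "(sigma CARD('n) (mat_scale c M))\<^sup>2 = (norm c)\<^sup>2 * (sigma CARD('n) M)\<^sup>2"
proof -
  have eq: "(norm (adjoint_mat (mat_scale c M) *v u))\<^sup>2 = (norm c)\<^sup>2 * (norm (adjoint_mat M *v u))\<^sup>2" for u
    by (simp add: adjoint_mat_scale_mult vec_herm.norm_sc power_mult_distrib)
  obtain w where w: "norm w = 1" "(norm (adjoint_mat M *v w))\<^sup>2 = (sigma CARD('n) M)\<^sup>2"
    using smallest_singular_value(3)[of M] by blast
  show ?thesis
  proof (rule smallest_singular_value_unique)
    fix u :: "'k^'n" assume "norm u = 1"
    then show "(norm c)\<^sup>2 * (sigma CARD('n) M)\<^sup>2 \<le> (norm (adjoint_mat (mat_scale c M) *v u))\<^sup>2"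
      using smallest_singular_value(2)[of M u] by (simp add: eq mult_left_mono)
  qed (use w eq in auto)
qed

text \<open>A minimum of functions with a common Lipschitz constant.\<close>

lemma smallest_singular_value_lipschitz:
  fixes M N :: "'k::rc_scalar^'m^'n"
  shows "sigma CARD('n) M \<le> sigma CARD('n) N + norm (M - N)"
proof -
  obtain u where u: "norm u = 1" "(norm (adjoint_mat N *v u))\<^sup>2 = (sigma CARD('n) N)\<^sup>2"
    using smallest_singular_value(3)[of N] by blast
  then have N: "norm (adjoint_mat N *v u) = sigma CARD('n) N"
    using smallest_singular_value(1)[of N] by (simp add: power2_eq_iff_nonneg)
  have "sigma CARD('n) M \<le> norm (adjoint_mat M *v u)"
    using smallest_singular_value(2)[of M u] u by (auto intro: power2_le_imp_le)
  also have "adjoint_mat M *v u = adjoint_mat N *v u + adjoint_mat (M - N) *v u"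
    using linear_diff[OF bounded_linear.linear[OF bounded_linear_adjoint_mult], of M N u] by simp
  also have "norm \<dots> \<le> norm (adjoint_mat N *v u) + norm (adjoint_mat (M - N) *v u)"
    by (rule norm_triangle_ineq)
  also have "\<dots> \<le> sigma CARD('n) N + norm (M - N)"
    using norm_adjoint_mult_le[of "M - N" u] u N by simp
  finally show ?thesis .
qed

lemma continuous_on_smallest_singular_value:
  "continuous_on S (\<lambda>M :: 'k::rc_scalar^'m^'n. sigma CARD('n) M)"
proof -
  have "\<bar>sigma CARD('n) M - sigma CARD('n) N\<bar> \<le> dist M N" for M N :: "'k^'m^'n"
    using smallest_singular_value_lipschitz[of M N] smallest_singular_value_lipschitz[of N M]
    by (simp add: dist_norm norm_minus_commute abs_le_iff)
  then have "1-lipschitz_on S (\<lambda>M :: 'k^'m^'n. sigma CARD('n) M)"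
    by (auto simp: lipschitz_on_def dist_real_def)
  then show ?thesis by (rule lipschitz_on_continuous_on)
qed

text \<open>A kernel vector of \<open>M\<^sup>*\<close> is a linear relation between the rows of \<open>M\<close>.\<close>

lemma full_rank_imp_smallest_singular_value_pos:
  fixes M :: "'k::rc_scalar^'m^'n"
  assumes "rank M = CARD('n)"
  shows "sigma CARD('n) M > 0"
proof (rule ccontr)
  assume "\<not> sigma CARD('n) M > 0"
  then have "sigma CARD('n) M = 0"
    using smallest_singular_value(1)[of M] by simp
  then obtain u where u: "norm u = 1" "adjoint_mat M *v u = 0"
    using smallest_singular_value(3)[of M] by auto
  have "u \<noteq> 0" using u by auto
  then obtain i where i: "u $ i \<noteq> 0" by (auto simp: vec_eq_iff)
  then have ci: "cconj (u $ i) \<noteq> 0" by (metis norm_cconj norm_eq_zero)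
  have "(\<Sum>k\<in>UNIV. cconj (u $ k) *s row k M) = 0"
  proof -
    have "(\<Sum>k\<in>UNIV. cconj (u $ k) * M $ k $ j) = cconj ((adjoint_mat M *v u) $ j)" for j
      by (simp add: adjoint_mat_def matrix_vector_mult_def cconj_sum cconj_mult mult.commute)
    then show ?thesis by (simp add: vec_eq_iff row_def u)
  qed
  then have sum: "cconj (u $ i) *s row i M + (\<Sum>k\<in>UNIV - {i}. cconj (u $ k) *s row k M) = 0"
    by (subst (asm) sum.remove[of UNIV i]) auto
  let ?R = "(\<lambda>k. row k M) ` (UNIV - {i})"
  have "(\<Sum>k\<in>UNIV - {i}. cconj (u $ k) *s row k M) \<in> vec.span ?R"
    by (intro vec.span_sum vec.span_scale vec.span_base) auto
  then have "inverse (cconj (u $ i)) *s (- (\<Sum>k\<in>UNIV - {i}. cconj (u $ k) *s row k M)) \<in> vec.span ?R"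
    by (intro vec.span_scale vec.span_neg)
  moreover have "inverse (cconj (u $ i)) *s (- (\<Sum>k\<in>UNIV - {i}. cconj (u $ k) *s row k M)) = row i M"
    using ci by (subst minus_unique[of "\<Sum>k\<in>UNIV - {i}. cconj (u $ k) *s row k M" "cconj (u $ i) *s row i M"])
      (use sum in \<open>auto simp: add.commute\<close>)
  ultimately have "row i M \<in> vec.span ?R" by simp
  then have "row k M \<in> vec.span ?R" for k
    by (cases "k = i") (auto intro: vec.span_base)
  then have "rows M \<subseteq> vec.span ?R"
    by (auto simp: rows_def)
  then have "rank M \<le> card ?R"
    unfolding row_rank_def_gen by (intro vec.dim_le_card) auto
  also have "\<dots> \<le> card (UNIV - {i})"
    by (rule card_image_le) simp
  also have "\<dots> < CARD('n)"
    by (simp add: card_Diff_singleton)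
  finally show False using assms by simp
qed

section \<open>Smoothness of simple roots\<close>

text \<open>Near a point where a factor vanishes, continuity of the other factor is enough for
  differentiability of the product.\<close>

lemma has_derivative_mult_continuous:
  fixes g r :: "'a::real_normed_vector \<Rightarrow> 'b::real_normed_algebra"
  assumes g: "(g has_derivative g') (at x)" and "g x = 0" and r: "isCont r x"
  shows "((\<lambda>y. r y * g y) has_derivative (\<lambda>v. r x * g' v)) (at x)"
proof -
  interpret g': bounded_linear g' by (rule has_derivative_bounded_linear[OF g])
  obtain B where B: "\<And>v. norm (g' v) \<le> norm v * B"
    using g'.bounded by blast
  have lim: "((\<lambda>y. norm (g y - g x - g' (y - x)) / norm (y - x)) \<longlongrightarrow> 0) (at x)"
    using g by (simp add: has_derivative_iff_norm)
  have lr: "((\<lambda>y. norm (r y)) \<longlongrightarrow> norm (r x)) (at x)"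
    using r by (intro tendsto_norm) (simp add: isCont_def)
  have ld: "((\<lambda>y. norm (r y - r x)) \<longlongrightarrow> 0) (at x)"
    using r by (simp add: isCont_def LIM_zero_iff tendsto_norm_zero_iff)
  have "((\<lambda>y. norm (r y) * (norm (g y - g x - g' (y - x)) / norm (y - x)) + norm (r y - r x) * B) \<longlongrightarrow> norm (r x) * 0 + 0 * B) (at x)"
    by (intro tendsto_intros lim lr ld)
  then have lim0: "((\<lambda>y. norm (r y) * (norm (g y - g x - g' (y - x)) / norm (y - x)) + norm (r y - r x) * B) \<longlongrightarrow> 0) (at x)"
    by simp
  have bound: "norm (norm (r y * g y - r x * g x - r x * g' (y - x)) / norm (y - x))
      \<le> norm (r y) * (norm (g y - g x - g' (y - x)) / norm (y - x)) + norm (r y - r x) * B" if "y \<noteq> x" for y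
  proof -
    have "r y * g y - r x * g x - r x * g' (y - x) = r y * (g y - g x - g' (y - x)) + (r y - r x) * g' (y - x)"
      using \<open>g x = 0\<close> by (simp add: right_diff_distrib left_diff_distrib)
    also have "norm \<dots> \<le> norm (r y) * norm (g y - g x - g' (y - x)) + norm (r y - r x) * norm (g' (y - x))"
      by (intro order_trans[OF norm_triangle_ineq] add_mono norm_mult_ineq)
    also have "\<dots> \<le> norm (r y) * norm (g y - g x - g' (y - x)) + norm (r y - r x) * (norm (y - x) * B)"
      by (intro add_left_mono mult_left_mono B norm_ge_zero)
    finally have "norm (r y * g y - r x * g x - r x * g' (y - x)) / norm (y - x)
      \<le> (norm (r y) * norm (g y - g x - g' (y - x)) + norm (r y - r x) * (norm (y - x) * B)) / norm (y - x)"
      by (rule divide_right_mono) simp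
    also have "\<dots> = norm (r y) * (norm (g y - g x - g' (y - x)) / norm (y - x)) + norm (r y - r x) * B"
      using that by (simp add: add_divide_distrib)
    finally show ?thesis by simp
  qed
  have "\<forall>\<^sub>F y in at x. norm (norm (r y * g y - r x * g x - r x * g' (y - x)) / norm (y - x))
      \<le> norm (r y) * (norm (g y - g x - g' (y - x)) / norm (y - x)) + norm (r y - r x) * B"
    unfolding eventually_at_filter by (rule always_eventually) (use bound in blast)
  from Lim_null_comparison[OF this lim0]
  have "((\<lambda>y. norm (r y * g y - r x * g x - r x * g' (y - x)) / norm (y - x)) \<longlongrightarrow> 0) (at x)" .
  moreover have "bounded_linear (\<lambda>v. r x * g' v)"
    by (rule bounded_linear_compose[OF bounded_linear_mult_right has_derivative_bounded_linear[OF g]])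
  ultimately show ?thesis
    by (simp add: has_derivative_iff_norm)
qed

lemma poly_eq_sum_le:
  fixes p :: "'a::comm_semiring_1 poly"
  assumes "degree p \<le> N"
  shows "poly p z = (\<Sum>j\<le>N. coeff p j * z ^ j)"
  unfolding poly_altdef using assms
  by (intro sum.mono_neutral_left) (auto simp: coeff_eq_0)

lemma poly_pderiv_eq_sum_le:
  fixes p :: "'a::real_normed_field poly"
  assumes "degree p \<le> N"
  shows "poly (pderiv p) z = (\<Sum>j\<le>N. coeff p j * (of_nat j * z ^ (j - 1)))"
proof -
  have "((\<lambda>z. \<Sum>j\<le>N. coeff p j * z ^ j) has_field_derivative (\<Sum>j\<le>N. coeff p j * (of_nat j * z ^ (j - 1)))) (at z)"
    by (auto intro!: derivative_eq_intros sum.cong)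
  moreover have "((\<lambda>z. \<Sum>j\<le>N. coeff p j * z ^ j) has_field_derivative poly (pderiv p) z) (at z)"
    using poly_DERIV[of p z] by (simp add: poly_eq_sum_le[OF assms, abs_def])
  ultimately show ?thesis
    by (rule DERIV_unique[symmetric])
qed

text \<open>The difference quotient of the polynomial in its variable is continuous and equal to the
  derivative at the root, so that the root is a product as in the previous lemma.\<close>

lemma simple_root_has_derivative:
  fixes p :: "'e::real_normed_vector \<Rightarrow> 'k::real_normed_field poly"
  assumes "open U" and coeff: "\<And>j x. x \<in> U \<Longrightarrow> ((\<lambda>x. coeff (p x) j) has_derivative a j x) (at x)"
    and deg: "\<And>x. x \<in> U \<Longrightarrow> degree (p x) \<le> N" and l: "continuous_on U l"
    and root: "\<And>x. x \<in> U \<Longrightarrow> poly (p x) (l x) = 0" and simple: "poly (pderiv (p x)) (l x) \<noteq> 0"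
    and x: "x \<in> U"
  shows "(l has_derivative (\<lambda>v. - inverse (poly (pderiv (p x)) (l x)) * (\<Sum>j\<le>N. a j x v * l x ^ j))) (at x)"
proof -
  \<comment> \<open>The difference quotient between \<open>l x\<close> and \<open>l y\<close> of the polynomial at parameter \<open>y\<close>.\<close>
  define q where "q y = (\<Sum>j\<le>N. coeff (p y) j * (\<Sum>i<j. l x ^ (j - Suc i) * l y ^ i))" for y
  define G where "G y = (\<Sum>j\<le>N. coeff (p y) j * l x ^ j)" for y
  have lc: "isCont l x"
    using l \<open>open U\<close> x by (simp add: continuous_on_eq_continuous_at)
  have ac: "isCont (\<lambda>y. coeff (p y) j) x" for j
    using has_derivative_continuous[OF coeff[OF x]] .
  have qc: "isCont q x"
    unfolding q_def by (intro continuous_intros lc ac)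
  have "(\<Sum>i<j. l x ^ (j - Suc i) * l x ^ i) = of_nat j * l x ^ (j - 1)" for j
  proof -
    have "(\<Sum>i<j. l x ^ (j - Suc i) * l x ^ i) = (\<Sum>i<j. l x ^ (j - 1))"
      by (intro sum.cong refl) (simp flip: power_add)
    then show ?thesis by simp
  qed
  then have qx: "q x = poly (pderiv (p x)) (l x)"
    by (simp add: q_def poly_pderiv_eq_sum_le[OF deg[OF x]])
  have G: "(G has_derivative (\<lambda>v. \<Sum>j\<le>N. a j x v * l x ^ j)) (at x)"
    unfolding G_def by (intro has_derivative_sum has_derivative_mult_left coeff x)
  have "isCont (\<lambda>y. - inverse (q y)) x"
    using simple qx by (intro continuous_intros qc) auto
  moreover have "G x = 0"
    using root[OF x] by (simp add: G_def poly_eq_sum_le[OF deg[OF x]])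
  ultimately have "((\<lambda>y. - inverse (q y) * G y) has_derivative
      (\<lambda>v. - inverse (q x) * (\<Sum>j\<le>N. a j x v * l x ^ j))) (at x)"
    using has_derivative_mult_continuous[OF G] by blast
  then have D: "((\<lambda>y. l x + - inverse (q y) * G y) has_derivative
      (\<lambda>v. - inverse (q x) * (\<Sum>j\<le>N. a j x v * l x ^ j))) (at x)"
    using has_derivative_add[OF has_derivative_const] by fastforce
  have "\<forall>\<^sub>F y in nhds x. q y \<noteq> 0"
    using qc simple[folded qx] unfolding isCont_def tendsto_at_iff_tendsto_nhds
    by (rule tendsto_imp_eventually_ne)
  moreover have "\<forall>\<^sub>F y in nhds x. y \<in> U"
    using \<open>open U\<close> x by (rule eventually_nhds_in_open)
  ultimately have "\<forall>\<^sub>F y in nhds x. l x + - inverse (q y) * G y = l y"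
  proof eventually_elim
    case (elim y)
    have "(l y - l x) * q y = (\<Sum>j\<le>N. coeff (p y) j * (l y ^ j - l x ^ j))"
      by (simp add: q_def power_diff_sumr2 sum_distrib_left mult_ac)
    also have "\<dots> = - G y"
      using root[OF elim(2)]
      by (simp add: G_def poly_eq_sum_le[OF deg[OF elim(2)]] right_diff_distrib sum_subtractf)
    finally show ?case
      using elim(1) by (simp add: field_simps)
  qed
  then have "\<forall>\<^sub>F y in at x. l x + - inverse (q y) * G y = l y"
    by (simp add: eventually_at_filter eventually_mono)
  from has_derivative_transform_eventually[OF D this] show ?thesis
    using \<open>G x = 0\<close> by (simp add: qx)
qed

text \<open>The derivative of the root is a rational expression in the root, the coefficients and their
  derivatives; hence the root is of class \<open>C\<^sup>k\<^sup>+\<^sup>1\<close> as soon as it is of class \<open>C\<^sup>k\<close>.\<close>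

theorem simple_root_Ck:
  fixes p :: "'e::real_normed_vector \<Rightarrow> 'k::real_normed_field poly"
  assumes "open U" and coeff: "\<And>j k. Ck_on k U (\<lambda>x. coeff (p x) j)"
    and deg: "\<And>x. x \<in> U \<Longrightarrow> degree (p x) \<le> N" and l: "continuous_on U l"
    and root: "\<And>x. x \<in> U \<Longrightarrow> poly (p x) (l x) = 0"
    and simple: "\<And>x. x \<in> U \<Longrightarrow> poly (pderiv (p x)) (l x) \<noteq> 0"
  shows "Ck_on k U l"
proof (induction k)
  case 0
  show ?case using l by simp
next
  case (Suc k)
  show ?case
  proof (rule Ck_on_SucI'[OF \<open>open U\<close>])
    show "(l has_derivative (\<lambda>v. - inverse (\<Sum>j\<le>N. coeff (p x) j * (of_nat j * l x ^ (j - 1)))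
        * (\<Sum>j\<le>N. dir (\<lambda>x. coeff (p x) j) v x * l x ^ j))) (at x)" if "x \<in> U" for x
      using simple_root_has_derivative[OF \<open>open U\<close> Ck_on_has_derivative[OF coeff] deg l root simple[OF that] that]
      by (simp add: poly_pderiv_eq_sum_le[OF deg[OF that]])
    have nz: "(\<Sum>j\<le>N. coeff (p x) j * (of_nat j * l x ^ (j - 1))) \<noteq> 0" if "x \<in> U" for x
      using simple[OF that] unfolding poly_pderiv_eq_sum_le[OF deg[OF that]] .
    show "Ck_on k U (\<lambda>x. - inverse (\<Sum>j\<le>N. coeff (p x) j * (of_nat j * l x ^ (j - 1)))
        * (\<Sum>j\<le>N. dir (\<lambda>x. coeff (p x) j) v x * l x ^ j))" for v
      using nz \<open>open U\<close>
      by (intro Ck_on_mult Ck_on_uminus Ck_on_inverse Ck_on_sum Ck_on_power Ck_on_const coeff Suc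
          Ck_on_dir[OF coeff]) auto
  qed (use \<open>open U\<close> in auto)
qed

text \<open>By the Leibniz formula the coefficients are polynomials in the entries.\<close>

lemma Ck_on_charpoly_coeff:
  fixes A :: "'e::real_normed_vector \<Rightarrow> 'k::real_normed_field^'n^'n"
  assumes U: "open U" and A: "\<And>i j. Ck_on k U (\<lambda>x. A x $ i $ j)"
  shows "Ck_on k U (\<lambda>x. coeff (charpoly (A x)) l)"
proof -
  have prod: "Ck_on k U (\<lambda>x. coeff (\<Prod>i\<in>I. f i x) l)"
    if "finite I" "\<And>i l. Ck_on k U (\<lambda>x. coeff (f i x) l)" for I :: "'n set" and f :: "'n \<Rightarrow> 'e \<Rightarrow> 'k poly" and l
    using that
  proof (induction I arbitrary: l)
    case empty
    show ?case using U by (simp add: Ck_on_const)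
  next
    case (insert i I)
    then show ?case
      using U by (simp add: coeff_mult) (intro Ck_on_sum Ck_on_mult, auto)
  qed
  have entry: "Ck_on k U (\<lambda>x. coeff (if i = j then [:- (A x $ i $ j), 1:] else [:- (A x $ i $ j):]) l)" for i j l
    using U A[of i j]
    by (cases "i = j"; cases l) (auto simp: coeff_pCons intro!: Ck_on_uminus Ck_on_const split: nat.split)
  have sign: "coeff (of_int z * q) l = of_int z * coeff q l" for z and q :: "'k poly" and l
    by (simp add: of_int_poly)
  show ?thesis
    unfolding charpoly_def det_def coeff_sum sign
    by (intro Ck_on_sum Ck_on_mult Ck_on_const prod U) (auto intro: entry)
qed

text \<open>The squared singular value is used since it, rather than the singular value, is an eigenvalue.\<close>

theorem Ck_on_smallest_singular_value:
  fixes M :: "'e::real_normed_vector \<Rightarrow> 'k::rc_scalar^'m^'n"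
  assumes U: "open U" and M: "\<And>k. Ck_on k U M"
    and simple: "\<And>x. x \<in> U \<Longrightarrow> CARD('n) \<ge> 2 \<longrightarrow> sigma (CARD('n) - 1) (M x) > sigma CARD('n) (M x)"
  shows "Ck_on k U (\<lambda>x. (sigma CARD('n) (M x))\<^sup>2)"
proof -
  define l :: "'e \<Rightarrow> 'k" where "l x = of_real ((sigma CARD('n) (M x))\<^sup>2)" for x
  have entry: "Ck_on k U (\<lambda>x. M x $ i $ j)" for i j k
    using U by (intro Ck_on_bounded_linear[OF _ bounded_linear_vec_nth] M)
  have gram: "Ck_on k U (\<lambda>x. (M x ** adjoint_mat (M x)) $ i $ j)" for i j k
    unfolding matrix_matrix_mult_def adjoint_mat_def using U
    by (simp, intro Ck_on_sum Ck_on_mult Ck_on_bounded_linear[OF _ bounded_linear_cconj] entry)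
  have "Ck_on k U l"
  proof (rule simple_root_Ck[OF U])
    show "continuous_on U l"
      unfolding l_def
      by (intro continuous_intros continuous_on_compose2[OF continuous_on_smallest_singular_value
          Ck_on_imp_continuous_on[OF M]]) auto
  qed (use smallest_singular_value(4-6) simple in \<open>auto simp: l_def simp del: of_real_power intro: Ck_on_charpoly_coeff[OF U gram]\<close>)
  then have "Ck_on k U (\<lambda>x. inner (l x) 1)"
    using Ck_on_bounded_linear[OF U bounded_linear_inner_left] by blast
  then show ?thesis
    by (simp add: l_def del: of_real_power)
qed

section \<open>Christoffel symbols\<close>

lemma christoffel_cong:
  assumes "open U" "x \<in> U" and eq: "\<And>y u w. y \<in> U \<Longrightarrow> G y u w = g y u w"
    and g: "\<And>u w. (\<lambda>y. g y u w) differentiable (at x)"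
  shows "christoffel G x u v w = christoffel g x u v w"
proof -
  have "dir (\<lambda>y. G y u w) e x = dir (\<lambda>y. g y u w) e x" for u w e
    by (rule dir_cong[OF assms(1,2)]) (use eq g in \<open>auto simp: frechet_derivative_works[symmetric]\<close>)
  then show ?thesis by (simp add: christoffel_def)
qed

lemma christoffel_add:
  assumes "\<And>u w. (\<lambda>y. g y u w) differentiable (at x)" "\<And>u w. (\<lambda>y. h y u w) differentiable (at x)"
  shows "christoffel (\<lambda>y u w. g y u w + h y u w) x u v w = christoffel g x u v w + christoffel h x u v w"
proof -
  have "dir (\<lambda>y. g y u w + h y u w) e x = dir (\<lambda>y. g y u w) e x + dir (\<lambda>y. h y u w) e x" for u w e
    by (rule dir_eqI) (intro has_derivative_add frechet_derivative_works[THEN iffD1] assms)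
  then show ?thesis by (simp add: christoffel_def field_simps)
qed

text \<open>For equal first two arguments, as in the geodesic equation, the two positive terms of Koszul's formula
  coincide.\<close>

lemma christoffel_conformal:
  fixes a :: "'e::euclidean_space \<Rightarrow> real"
  assumes "a differentiable (at x)" "\<And>u w. (\<lambda>y. g y u w) differentiable (at x)"
  shows "christoffel (\<lambda>y u w. a y * g y u w) x v v w
    = a x * christoffel g x v v w + dir a v x * g x v w - dir a w x * g x v v / 2"
proof -
  have "dir (\<lambda>y. a y * g y u w) e x = a x * dir (\<lambda>y. g y u w) e x + dir a e x * g x u w" for u w e
    by (rule dir_eqI) (intro has_derivative_mult frechet_derivative_works[THEN iffD1] assms)
  then show ?thesis by (simp add: christoffel_def field_simps)
qed

text \<open>Differentiating the relation that the base point is a unit vector.\<close>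

lemma unit_lift_derivatives:
  fixes X :: "'e::real_normed_vector \<Rightarrow> 'v::real_inner"
  assumes U: "open U" and X: "Ck_on 2 U X" and unit: "\<And>y. y \<in> U \<Longrightarrow> norm (X y) = 1" and x: "x \<in> U"
  shows "inner (dir X v x) (X x) = 0"
    and "inner (dir (dir X v) w x) (X x) = - inner (dir X v x) (dir X w x)"
proof -
  have X1: "Ck_on (Suc (Suc 0)) U X" using X by (simp only: numeral_2_eq_2)
  note dX = Ck_on_has_derivative[OF X1] and ddX = Ck_on_has_derivative[OF Ck_on_dir[OF X1]]
  have tangent: "inner (dir X v y) (X y) = 0" if y: "y \<in> U" for y v
  proof -
    have "((\<lambda>y. inner (X y) (X y)) has_derivative (\<lambda>v. inner (X y) (dir X v y) + inner (dir X v y) (X y))) (at y)"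
      by (intro has_derivative_inner dX y)
    moreover have "((\<lambda>y. inner (X y) (X y)) has_derivative (\<lambda>v. 0)) (at y)"
      by (rule has_derivative_transform_within_open[OF has_derivative_const[of 1] U y])
        (simp add: unit flip: power2_norm_eq_inner)
    ultimately have "(\<lambda>v. inner (X y) (dir X v y) + inner (dir X v y) (X y)) = (\<lambda>v. 0)"
      by (rule has_derivative_unique)
    from fun_cong[OF this, of v] show ?thesis
      by (simp add: inner_commute)
  qed
  then show "inner (dir X v x) (X x) = 0" using x .
  have "((\<lambda>y. inner (dir X v y) (X y)) has_derivative
      (\<lambda>w. inner (dir X v x) (dir X w x) + inner (dir (dir X v) w x) (X x))) (at x)"
    by (intro has_derivative_inner dX ddX x)
  moreover have "((\<lambda>y. inner (dir X v y) (X y)) has_derivative (\<lambda>w. 0)) (at x)"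
    by (rule has_derivative_transform_within_open[OF has_derivative_const[of 0] U x]) (simp add: tangent)
  ultimately have "(\<lambda>w. inner (dir X v x) (dir X w x) + inner (dir (dir X v) w x) (X x)) = (\<lambda>w. 0)"
    by (rule has_derivative_unique)
  from fun_cong[OF this, of w] show "inner (dir (dir X v) w x) (X x) = - inner (dir X v x) (dir X w x)"
    by simp
qed

context hermitian_space
begin

text \<open>The metric of the projective space, written in a chart through a lift \<open>X\<close> to the sphere.\<close>

definition lift_metric :: "('e::real_normed_vector \<Rightarrow> 'v) \<Rightarrow> 'e \<Rightarrow> 'e \<Rightarrow> 'e \<Rightarrow> real" where
  "lift_metric X y u w = fubini_study (X y) (dir X u y) (dir X w y)"

lemma lift_metric_has_derivative:
  assumes X: "Ck_on 2 U X" and x: "x \<in> U"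
  shows "((\<lambda>y. lift_metric X y u w) has_derivative (\<lambda>e.
      (inner (dir X u x) (dir (dir X w) e x) + inner (dir (dir X u) e x) (dir X w x))
      - (inner (hm (dir X u x) (X x)) (hm (dir X w x) (dir X e x) + hm (dir (dir X w) e x) (X x))
         + inner (hm (dir X u x) (dir X e x) + hm (dir (dir X u) e x) (X x)) (hm (dir X w x) (X x))))) (at x)"
proof -
  have X1: "Ck_on (Suc (Suc 0)) U X" using X by (simp only: numeral_2_eq_2)
  note dX = Ck_on_has_derivative[OF X1] and ddX = Ck_on_has_derivative[OF Ck_on_dir[OF X1]]
  show ?thesis
    unfolding lift_metric_def fubini_study_def
    by (intro has_derivative_diff has_derivative_inner hm.FDERIV dX ddX x)
qed

text \<open>The first summand is the naive acceleration; the second is the Coriolis term caused by the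
  vertical velocity of the lift.\<close>

lemma christoffel_lift_metric:
  fixes X :: "'e::euclidean_space \<Rightarrow> 'v"
  assumes U: "open U" and X: "Ck_on 2 U X" and unit: "\<And>y. y \<in> U \<Longrightarrow> norm (X y) = 1" and x: "x \<in> U"
  shows "christoffel (lift_metric X) x v v w = fubini_study (X x) (dir (dir X v) v x) (dir X w x)
    + 2 * inner (hm (dir X v x) (X x)) (hm (dir X v x) (dir X w x))"
proof -
  note d = dir_eqI[OF lift_metric_has_derivative[OF X x]]
  let ?p = "hm (dir X v x) (X x)" and ?q = "hm (dir X v x) (dir X w x)" and ?r = "hm (dir X w x) (X x)"
  have sym: "dir (dir X v) w x = dir (dir X w) v x"
    by (rule dir_dir_commute[OF U X x])
  have tan: "inner (dir X e x) (X x) = 0" for e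
    using unit_lift_derivatives(1)[OF U X unit x] .
  have im: "inner (hm (dir X v x) (dir X v x)) ?r = 0"
  proof -
    have "inner (hm (dir X v x) (dir X v x)) ?r = (norm (dir X v x))\<^sup>2 * inner ?r 1"
      by (simp add: hm_self of_real_def inner_commute)
    then show ?thesis by (simp add: inner_hm_one tan)
  qed
  have conj: "inner ?p (hm (dir X w x) (dir X v x)) = - inner ?p ?q"
  proof -
    have "inner ?p (cconj ?q) = inner (?q * ?p) 1"
      using scalar_inner_mult_left[of ?q ?p 1] scalar_inner_mult_left[of "?q" "?p" 1]
      by simp
    also have "\<dots> = inner (?p * ?q) 1" by (simp add: mult.commute)
    also have "\<dots> = inner ?q (cconj ?p)"
      using scalar_inner_mult_left[of ?p ?q 1] by simp
    finally have "inner ?p (cconj ?q) = inner (cconj ?p) ?q"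
      by (simp add: inner_commute)
    moreover have "cconj ?p = - ?p"
      by (rule imaginary_cconj) (simp add: inner_hm_one tan)
    ultimately show ?thesis
      using hm_commute[of "dir X w x" "dir X v x"] by simp
  qed
  show ?thesis
    unfolding christoffel_def d fubini_study_def
    using im conj by (simp add: sym inner_add_left inner_add_right inner_commute field_simps)
qed

end

section \<open>The tangent space of the solution variety\<close>

text \<open>A point of the lift may differ by unit scalars from the representatives that witness membership in
  the variety; they do not change \<open>M M\<^sup>*\<close>.\<close>

lemma sphere_lift_W_gt:
  fixes q :: "('k::rc_scalar^'m^'n) \<times> ('k^'m)"
  assumes card: "CARD('m) = CARD('n) + 1" and q: "q \<in> sphere_lift W_gt"
  shows "norm (fst q) = 1" "norm (snd q) = 1" "fst q *v snd q = 0"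
    and "sigma CARD('n) (fst q) > 0"
    and "CARD('n) \<ge> 2 \<longrightarrow> sigma (CARD('n) - 1) (fst q) > sigma CARD('n) (fst q)"
    and "alpha2 (pp_proj q) = inverse ((sigma CARD('n) (fst q))\<^sup>2)"
proof -
  obtain M :: "'k^'m^'n" and z :: "'k^'m" where Mz: "norm M = 1" "norm z = 1" "M \<in> GL_gt" "M *v z = 0"
    and eq: "proj mat_scale (fst q) = proj mat_scale M" "proj (*s) (snd q) = proj (*s) z"
    using q by (auto simp: sphere_lift_def W_gt_def pp_proj_def)
  show n1: "norm (fst q) = 1" and n2: "norm (snd q) = 1"
    using q by (auto simp: sphere_lift_def mem_Times_iff)
  have "mat_scale 1 (fst q) \<in> proj mat_scale (fst q)"
    unfolding proj_def by (rule rangeI)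
  moreover have "1 *s snd q \<in> proj (*s) (snd q)"
    unfolding proj_def by (rule rangeI)
  ultimately have "fst q \<in> proj mat_scale M" "snd q \<in> proj (*s) z"
    by (simp_all add: eq)
  then obtain c e where c: "fst q = mat_scale c M" and e: "snd q = e *s z"
    by (auto simp: proj_def)
  have "norm c = 1"
    using n1 Mz mat_herm.norm_sc[of c M] c by simp
  then have "c * cconj c = 1" by (simp add: mult_cconj)
  have "fst q ** adjoint_mat (fst q) = M ** adjoint_mat M"
  proof -
    have cc: "c * a * cconj (c * b) = a * cconj b" for a b
    proof -
      have "c * a * cconj (c * b) = (c * cconj c) * (a * cconj b)"
        by (simp add: cconj_mult mult_ac)
      then show ?thesis using \<open>c * cconj c = 1\<close> by simp
    qed
    show ?thesis
      by (simp add: c mat_scale_def adjoint_mat_def matrix_matrix_mult_def vec_eq_iff)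
        (intro allI sum.cong refl cc)
  qed
  then have sv: "sigma k (fst q) = sigma k M" for k
    by (simp add: sigma_def singular_values_def)
  show pos: "sigma CARD('n) (fst q) > 0"
    and "CARD('n) \<ge> 2 \<longrightarrow> sigma (CARD('n) - 1) (fst q) > sigma CARD('n) (fst q)"
    using Mz(3) full_rank_imp_smallest_singular_value_pos[of M] by (auto simp: GL_gt_def sv)
  have "c *s (e *s (M *v z)) = fst q *v snd q"
    by (simp add: c e vector_scalar_commute mat_scale_def matrix_vector_mult_def vec_eq_iff
        sum_distrib_left mult_ac)
  then show "fst q *v snd q = 0"
    using Mz by simp
  have scale: "(norm (mat_scale b (fst q)))\<^sup>2 / (sigma CARD('n) (mat_scale b (fst q)))\<^sup>2 = inverse ((sigma CARD('n) (fst q))\<^sup>2)"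
    if "mat_scale b (fst q) \<noteq> 0" for b
  proof -
    have "norm b \<noteq> 0" using that mat_herm.sc.zero_left[of "fst q"] by auto
    then show ?thesis
      using n1 by (simp add: mat_herm.norm_sc smallest_singular_value_scale field_simps)
  qed
  have "mat_scale 1 (fst q) \<in> proj mat_scale (fst q)"
    by (auto simp: proj_def simp del: mat_herm.sc_one)
  moreover have "mat_scale 1 (fst q) \<noteq> 0" using n1 by auto
  ultimately show "alpha2 (pp_proj q) = inverse ((sigma CARD('n) (fst q))\<^sup>2)"
    unfolding alpha2_def pp_proj_def fst_conv
  proof (intro the_equality)
    show "\<exists>N\<in>proj mat_scale (fst q). N \<noteq> 0 \<and> inverse ((sigma CARD('n) (fst q))\<^sup>2) = (norm N)\<^sup>2 / (sigma CARD('n) N)\<^sup>2"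
      if "mat_scale 1 (fst q) \<in> proj mat_scale (fst q)" "mat_scale 1 (fst q) \<noteq> 0"
      using that scale[of 1] by (intro bexI[of _ "mat_scale 1 (fst q)"]) auto
  qed (auto simp: proj_def scale)
qed

lemma bounded_bilinear_mat_vec:
  "bounded_bilinear ((*v) :: 'k::rc_scalar^'m^'n \<Rightarrow> 'k^'m \<Rightarrow> 'k^'n)"
proof (rule bilinear_conv_bounded_bilinear[THEN iffD1], unfold bilinear_def, intro conjI allI)
  show "linear (\<lambda>A :: 'k^'m^'n. A *v x)" for x
  proof (rule linearI)
    show "(r *\<^sub>R A) *v x = r *\<^sub>R (A *v x)" for r and A :: "'k^'m^'n"
      by (simp add: matrix_vector_mult_def vec_eq_iff scaleR_sum_right)
  qed (rule matrix_vector_mult_add_rdistrib)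
qed (rule linear_mat_vec)


text \<open>If \<open>b\<close> had a component \<open>b'\<close> orthogonal to \<open>z\<close>, then the \<open>n\<close>-dimensional range of \<open>M\<^sup>*\<close>, which is
  orthogonal to the kernel of \<open>M\<close>, together with \<open>z\<close> and \<open>b'\<close> would span too large a space.\<close>

lemma kernel_of_corank_one:
  fixes M :: "'k::rc_scalar^'m^'n"
  assumes card: "CARD('m) = CARD('n) + 1" and pos: "sigma CARD('n) M > 0"
    and z: "norm z = 1" "M *v z = 0" and b: "M *v b = 0"
  obtains c where "b = c *s z"
proof -
  define b' where "b' = b - vec_herm.hm b z *s z"
  have Mb': "M *v b' = 0"
    by (simp add: b'_def matrix_vector_mult_diff_distrib b vector_scalar_commute z)
  have hb': "vec_herm.hm b' z = 0"
    using z by (simp add: b'_def vec_herm.hm.diff_left vec_herm.hm_sc_self)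
  have "b' = 0"
  proof (rule ccontr)
    assume "b' \<noteq> 0"
    define L :: "('k^'n) \<times> 'k \<times> 'k \<Rightarrow> 'k^'m" where
      "L = (\<lambda>(u, c, e). adjoint_mat M *v u + (c *s z + e *s b'))"
    have lin: "linear L"
      using linear_mat_vec[of "adjoint_mat M"]
      by (auto intro!: linearI simp: L_def linear_add linear_scale vec_herm.sc.add_left vec_herm.sc.scaleR_left algebra_simps)
    have "inj L"
      unfolding linear_injective_0[OF lin]
    proof (intro allI impI)
      fix t assume "L t = 0"
      obtain u c e where t: "t = (u, c, e)" by (metis prod_cases3)
      let ?y = "c *s z + e *s b'"
      have zero: "adjoint_mat M *v u + ?y = 0" using \<open>L t = 0\<close> by (simp add: L_def t)
      have "inner (adjoint_mat M *v u) ?y = inner u (M *v ?y)"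
        using inner_mat_mult_left[of "adjoint_mat M" u ?y] by simp
      also have "M *v ?y = 0"
        by (simp add: matrix_vector_right_distrib vector_scalar_commute z Mb')
      finally have orth: "inner (adjoint_mat M *v u) ?y = 0" by simp
      have "?y = - (adjoint_mat M *v u)"
        using zero by (simp add: eq_neg_iff_add_eq_0 add.commute)
      with orth have Mu: "adjoint_mat M *v u = 0" by simp
      then have u: "u = 0"
        using smallest_singular_value(2)[of M u] pos by (simp add: mult_le_0_iff)
      have y: "?y = 0" using zero Mu by simp
      from arg_cong[OF y, of "\<lambda>y. vec_herm.hm y z"] have c: "c = 0"
        using z by (simp add: vec_herm.hm.add_left vec_herm.hm_sc_self vec_herm.hm_sc_left vec_herm.hm_self hb' vec_herm.hm.zero_left)
      then have "norm e * norm b' = 0"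
        using y vec_herm.norm_sc[of e b'] by simp
      then show "t = 0" using t u c \<open>b' \<noteq> 0\<close> by (simp add: zero_prod_def)
    qed
    then have "dim (range L) = DIM(('k^'n) \<times> 'k \<times> 'k)"
      using dim_image_eq[OF lin, of UNIV] by (simp add: dim_UNIV)
    moreover have "dim (range L) \<le> DIM('k^'m)"
      by (rule dim_subset_UNIV)
    ultimately show False
      using card DIM_positive[where 'a='k] by (simp add: algebra_simps)
  qed
  then show thesis using that by (simp add: b'_def)
qed

text \<open>A tangent vector is determined by its first component, since the second is then determined
  up to a vertical vector; hence a dimension count shows that, up to vertical vectors, all first
  components orthogonal to \<open>M\<close> occur. If \<open>W z = 0\<close>, the second component is vertical.\<close>

lemma tangent_space_contains:
  fixes L :: "'k^'d \<Rightarrow> ('k::rc_scalar^'m^'n) \<times> ('k^'m)"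
  assumes card: "CARD('d) = CARD('n) * CARD('m) - 1" and lin: "linear L"
    and M: "norm M = 1" and z: "norm z = 1" "M *v z = 0"
    and ker: "\<And>b. M *v b = 0 \<Longrightarrow> \<exists>c. b = c *s z"
    and tan1: "\<And>w. inner (fst (L w)) M = 0" and tan2: "\<And>w. inner (snd (L w)) z = 0"
    and eq: "\<And>w. fst (L w) *v z + M *v snd (L w) = 0"
    and pos: "\<And>w. w \<noteq> 0 \<Longrightarrow> pp_metric (M, z) (L w) (L w) > 0"
    and W: "inner W M = 0" "W *v z = 0"
  obtains w c c' where "inner c 1 = 0" "inner c' 1 = 0" "L w = (W - mat_scale c M, c' *s z)"
proof -
  have Mcz: "mat_scale c M *v z = 0" for c
  proof -
    have "mat_scale c M *v z = c *s (M *v z)"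
      by (simp add: mat_scale_def matrix_vector_mult_def vec_eq_iff sum_distrib_left mult.assoc)
    then show ?thesis by (simp add: z)
  qed
  have im: "inner c 1 = 0" if "inner (mat_scale c M) M = 0" for c
    using that M by (simp add: mat_herm.inner_sc_self)
  have im': "inner c 1 = 0" if "inner (c *s z) z = 0" for c
    using that z by (simp add: vec_herm.inner_sc_self)
  have snd: "\<exists>c'. inner c' 1 = 0 \<and> snd (L w) = c' *s z" if "fst (L w) *v z = 0" for w
  proof -
    have "M *v snd (L w) = 0" using eq[of w] that by simp
    then obtain c' where "snd (L w) = c' *s z" using ker by blast
    then show ?thesis using im'[of c'] tan2[of w] by auto
  qed
  \<comment> \<open>Source and target of this map have equal dimension, as the line through \<open>M\<close> is added to the source.\<close>
  define T where "T = (\<lambda>(w, c). fst (L w) + mat_scale c M)"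
  have linT: "linear T"
    using lin
    by (auto intro!: linearI simp: T_def linear_add linear_scale mat_herm.sc.add_left mat_herm.sc.scaleR_left algebra_simps)
  have "inj T"
    unfolding linear_injective_0[OF linT]
  proof (intro allI impI)
    fix t assume "T t = 0"
    obtain w c where t: "t = (w, c)" by (metis prod.exhaust)
    have f: "fst (L w) = mat_scale (- c) M"
      using \<open>T t = 0\<close> by (simp add: T_def t mat_herm.sc.minus_left eq_neg_iff_add_eq_0)
    then have "inner (- c) 1 = 0"
      using tan1[of w] by (intro im) simp
    obtain c' where "inner c' 1 = 0" and s: "snd (L w) = c' *s z"
      using snd[of w] f Mcz by auto
    have "pp_metric (M, z) (L w) (L w) = proj_metric mat_scale M (fst (L w)) (fst (L w))
        + proj_metric (*s) z (snd (L w)) (snd (L w))"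
      by (simp add: pp_metric_def)
    also have "\<dots> = mat_herm.fubini_study M (fst (L w)) (fst (L w)) + vec_herm.fubini_study z (snd (L w)) (snd (L w))"
      by (simp only: mat_herm.proj_metric_tangent[OF M tan1 tan1] vec_herm.proj_metric_tangent[OF z(1) tan2 tan2])
    also have "\<dots> = 0"
      unfolding f s by (simp only: mat_herm.fubini_study_vertical[OF M] vec_herm.fubini_study_vertical[OF z(1)])
    finally have w: "w = 0" using pos[of w] by force
    then have "mat_scale c M = 0"
      using f lin by (simp add: linear_0 mat_herm.sc.minus_left)
    then have "c = 0"
      using mat_herm.norm_sc[of c M] M by simp
    then show "t = 0" using t w by (simp add: zero_prod_def)
  qed
  then have "dim (range T) = DIM(('k^'d) \<times> 'k)"
    using dim_image_eq[OF linT, of UNIV] by (simp add: dim_UNIV)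
  moreover have "DIM(('k^'d) \<times> 'k) = DIM('k^'m^'n)"
  proof -
    have "CARD('n) * CARD('m) \<ge> 1" by (simp add: Suc_le_eq)
    then have "CARD('d) + 1 = CARD('n) * CARD('m)" using card by simp
    then have "(CARD('d) + 1) * DIM('k) = CARD('n) * CARD('m) * DIM('k)" by simp
    then show ?thesis by (simp add: mult.assoc)
  qed
  ultimately have "dim (range T) = DIM('k^'m^'n)" by simp
  then have "span (range T) = UNIV"
    by (simp only: dim_eq_full)
  moreover have "span (range T) = range T"
    using linear_subspace_image[OF linT subspace_UNIV] by (simp only: span_eq_iff)
  ultimately have "W \<in> range T" by simp
  then obtain w c where wc: "fst (L w) + mat_scale c M = W"
    unfolding T_def by auto
  have "inner (fst (L w) + mat_scale c M) M = 0"
    using wc W by simp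
  then have c: "inner c 1 = 0"
    using tan1[of w] by (intro im) (simp add: inner_add_left)
  have f: "fst (L w) = W - mat_scale c M"
    using wc by (simp add: algebra_simps)
  then have "fst (L w) *v z = 0"
    using W(2) Mcz[of c] by (simp add: matrix_vector_mult_diff_rdistrib)
  then obtain c' where c': "inner c' 1 = 0" "snd (L w) = c' *s z"
    using snd by blast
  show thesis
    by (rule that[OF c c'(1), of w]) (use f c'(2) in \<open>simp add: prod_eq_iff\<close>)
qed

section \<open>The differential inequality along geodesics\<close>

text \<open>Vertical vectors do not see the Coriolis term of \<open>christoffel_lift_metric\<close>, as it should be for a
  metric of the quotient.\<close>

lemma (in hermitian_space) coriolis_vertical:
  assumes x: "norm x = 1" and c: "inner c 1 = 0"
  shows "inner (hm a x) (hm a (sc c x)) = 0"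
proof -
  let ?p = "hm a x"
  have "inner ?p (hm a (sc c x)) = inner (hm a x) (?p * c)"
    by (metis inner_commute inner_hm sc_sc)
  also have "\<dots> = inner (c * ?p) ?p"
    by (simp add: inner_commute mult.commute)
  also have "\<dots> = inner c (?p * cconj ?p)"
    using scalar_inner_mult_left[of ?p c ?p] by (simp add: mult.commute)
  also have "\<dots> = (norm ?p)\<^sup>2 * inner c 1"
    by (simp add: mult_cconj)
  finally show ?thesis using c by simp
qed

lemma (in hermitian_space) inner_sc_same: "inner (sc c x) (sc c y) = (norm c)\<^sup>2 * inner x y"
proof -
  have "inner (sc c x) (sc c y) = inner x (sc (c * cconj c) y)"
    using inner_sc_left[of c x "sc c y"] by (simp add: sc_sc mult.commute)
  then show ?thesis by (simp add: mult_cconj sc.scaleR_left)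
qed

lemma outer_scale: "outer u (c *s y) = mat_scale (cconj c) (outer u y)"
  by (simp add: outer_def mat_scale_def vec_eq_iff cconj_mult mult.left_commute)

lemma outer_adjoint_mult_kernel:
  assumes "M *v z = 0"
  shows "outer u (adjoint_mat M *v u) *v z = 0"
proof -
  let ?y = "adjoint_mat M *v u"
  have "vec_herm.hm z ?y = 0"
  proof (rule vec_herm.hm_eqI)
    fix c
    have "inner z (c *s ?y) = inner (M *v z) (c *s u)"
      by (simp add: inner_mat_mult_left vector_scalar_commute)
    then show "inner z (c *s ?y) = inner 0 c" using assms by simp
  qed
  moreover have "(\<Sum>j\<in>UNIV. u $ i * cconj (?y $ j) * z $ j) = u $ i * vec_herm.hm z ?y" for i
    by (simp add: vec_hm sum_distrib_left mult_ac)
  ultimately show ?thesis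
    by (simp add: outer_def matrix_vector_mult_def vec_eq_iff)
qed

text \<open>The derivative of \<open>\<parallel>M\<^sup>* u\<parallel>\<^sup>2\<close> is \<open>2 \<langle>\<cdot>, Y\<rangle>\<close>, and \<open>Y - f M\<close> is the horizontal part of \<open>Y\<close>. Hence it is half the
  gradient on the projective space.\<close>

lemma gradient_direction:
  fixes M :: "'k::rc_scalar^'m^'n"
  assumes M: "norm M = 1" and u: "norm u = 1" and f: "f = (norm (adjoint_mat M *v u))\<^sup>2"
  defines "Y \<equiv> outer u (adjoint_mat M *v u)"
  shows "inner M Y = f" and "inner Y Y = f" and "inner (mat_scale c M) Y = inner c 1 * f"
    and "mat_herm.hm (Y - f *\<^sub>R M) M = 0" and "f \<le> 1"
proof -
  show MY: "inner (mat_scale c M) Y = inner c 1 * f" for c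
    using inner_adjoint_mult[of "mat_scale c M" u "adjoint_mat M *v u"]
    by (simp add: Y_def adjoint_mat_scale_mult vec_herm.inner_sc_self f inner_cconj_one)
  show "inner M Y = f"
    using MY[of 1] by simp
  show "inner Y Y = f"
    using norm_outer[of u "adjoint_mat M *v u"] u by (simp add: Y_def f flip: power2_norm_eq_inner)
  show "mat_herm.hm (Y - f *\<^sub>R M) M = 0"
  proof (rule mat_herm.hm_eqI)
    fix c
    have "inner M (mat_scale c M) = inner c 1" "inner Y (mat_scale c M) = inner c 1 * f"
      using mat_herm.inner_sc_self[of c M] MY[of c] M by (simp_all add: inner_commute)
    then show "inner (Y - f *\<^sub>R M) (mat_scale c M) = inner 0 c"
      by (simp add: inner_diff_left)
  qed
  show "f \<le> 1"
    using norm_adjoint_mult_le[of M u] M u by (simp add: f power_le_one)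
qed

text \<open>The algebraic heart of the proof, for a velocity \<open>V\<close> and an acceleration \<open>A\<close> of the matrix; \<open>q\<close> is
  the squared speed of the kernel. The premise \<open>geo\<close> is the geodesic equation tested against half the
  gradient, and the left-hand side of the conclusion is \<open>f\<close> times an upper bound for \<open>f''\<close>.\<close>

lemma core_inequality:
  fixes M :: "'k::rc_scalar^'m^'n"
  assumes M: "norm M = 1" and u: "norm u = 1" and f: "f = (norm (adjoint_mat M *v u))\<^sup>2" and "f > 0"
    and V: "inner V M = 0" and AM: "inner A M = - (norm V)\<^sup>2" and q: "q \<ge> 0"
  defines "Y \<equiv> outer u (adjoint_mat M *v u)"
  assumes geo: "inner A (Y - f *\<^sub>R M) + 2 * inner (mat_herm.hm V M) (mat_herm.hm V (Y - f *\<^sub>R M))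
      - 2 * (inner V Y)\<^sup>2 / f + (1 - f) * (mat_herm.fubini_study M V V + q) = 0"
  shows "f * (2 * (norm (adjoint_mat V *v u))\<^sup>2 + 2 * inner A Y) \<le> (2 * inner V Y)\<^sup>2"
proof -
  note g = gradient_direction[OF M u f, folded Y_def]
  define t where "t = mat_herm.hm V M"
  \<comment> \<open>The horizontal part of the velocity; \<open>t\<close> measures the vertical velocity of the lift.\<close>
  define N where "N = V - mat_scale t M"
  have V_eq: "V = N + mat_scale t M" by (simp add: N_def)
  have t0: "inner t 1 = 0" using V by (simp add: t_def mat_herm.inner_hm_one)
  have VM: "inner V (mat_scale t M) = (norm t)\<^sup>2"
    using mat_herm.inner_hm[of V M t] by (simp add: t_def power2_norm_eq_inner)
  have fs: "mat_herm.fubini_study M V V = (norm N)\<^sup>2"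
    using mat_herm.fubini_study_self[OF M, of V] by (simp add: N_def t_def)
  have V2: "(norm V)\<^sup>2 = (norm N)\<^sup>2 + (norm t)\<^sup>2"
    using fs by (simp add: mat_herm.fubini_study_def t_def power2_norm_eq_inner)
  \<comment> \<open>This cross term occurs in the Coriolis term and in the barrier, and cancels in the end.\<close>
  define X where "X = inner N (mat_scale t Y)"
  have coriolis: "inner (mat_herm.hm V M) (mat_herm.hm V (Y - f *\<^sub>R M)) = X"
  proof -
    have "inner (mat_herm.hm V M) (mat_herm.hm V (Y - f *\<^sub>R M)) = inner V (mat_scale t (Y - f *\<^sub>R M))"
      by (simp only: t_def[symmetric] inner_commute[of t] mat_herm.inner_hm)
    also have "\<dots> = inner V (mat_scale t Y) - f * (norm t)\<^sup>2"
      by (simp add: mat_herm.sc.diff_right mat_herm.sc.scaleR_right inner_diff_right VM)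
    also have "inner V (mat_scale t Y) = X + (norm t)\<^sup>2 * f"
      unfolding X_def by (subst V_eq) (simp add: inner_add_left mat_herm.inner_sc_same g(1))
    finally show ?thesis by simp
  qed
  have "adjoint_mat V *v u = adjoint_mat N *v u + cconj t *s (adjoint_mat M *v u)"
    using linear_add[OF bounded_linear.linear[OF bounded_linear_adjoint_mult], of N "mat_scale t M" u]
    by (simp add: V_eq[symmetric] adjoint_mat_scale_mult)
  moreover have "inner (adjoint_mat N *v u) (cconj t *s (adjoint_mat M *v u)) = X"
    by (simp add: inner_adjoint_mult outer_scale X_def Y_def)
  moreover have "inner (cconj t) (cconj t) = inner t t"
    by (simp flip: power2_norm_eq_inner)
  ultimately have "(norm (adjoint_mat V *v u))\<^sup>2 = (norm (adjoint_mat N *v u))\<^sup>2 + 2 * X + (norm t)\<^sup>2 * f"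
    by (simp add: power2_norm_eq_inner inner_add_left inner_add_right inner_commute
        vec_herm.inner_sc_sc f)
  note TV = this
  have TN: "(norm (adjoint_mat N *v u))\<^sup>2 \<le> (norm N)\<^sup>2"
    using norm_adjoint_mult_le[of N u] u by (simp add: power_mono)
  have AY: "inner A Y = inner A (Y - f *\<^sub>R M) - f * ((norm N)\<^sup>2 + (norm t)\<^sup>2)"
    by (simp add: inner_diff_right AM V2 algebra_simps)
  have AW: "inner A (Y - f *\<^sub>R M) = - 2 * X + 2 * (inner V Y)\<^sup>2 / f - (1 - f) * ((norm N)\<^sup>2 + q)"
    using geo unfolding coriolis fs by simp
  have "2 * (norm (adjoint_mat V *v u))\<^sup>2 + 2 * inner A Y
      \<le> 2 * (norm N)\<^sup>2 + 2 * ((norm t)\<^sup>2 * f) + 4 * (inner V Y)\<^sup>2 / f - 2 * ((1 - f) * ((norm N)\<^sup>2 + q))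
        - 2 * (f * ((norm N)\<^sup>2 + (norm t)\<^sup>2))"
    using TN unfolding TV AY AW by simp
  also have "\<dots> = 4 * (inner V Y)\<^sup>2 / f - 2 * ((1 - f) * q)"
    by (simp add: algebra_simps)
  also have "\<dots> \<le> 4 * (inner V Y)\<^sup>2 / f"
    using g(5) q by simp
  finally show ?thesis
    using \<open>f > 0\<close> by (simp add: field_simps power_mult_distrib)
qed

section \<open>Convexity from local second derivatives\<close>

text \<open>One-sided derivatives at the end points of the interval are included, and the first derivative
  is only given locally; it is unique unless the interval is degenerate.\<close>

lemma convex_on_if_local_second_derivative:
  fixes h :: "real \<Rightarrow> real"
  assumes I: "is_interval I"
    and loc: "\<And>t. t \<in> I \<Longrightarrow> \<exists>\<delta>>0. \<exists>h'. \<exists>D\<ge>0.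
      (\<forall>s\<in>I. \<bar>s - t\<bar> < \<delta> \<longrightarrow> (h has_real_derivative h' s) (at s within I)) \<and>
      (h' has_real_derivative D) (at t within I)"
  shows "convex_on I h"
proof (cases "\<exists>a. I = {a}")
  case True
  then show ?thesis
    by (auto simp: convex_on_def simp flip: distrib_right)
next
  case False
  have conv: "convex I" using I by (simp add: is_interval_convex_1)
  have nonbot: "at t within I \<noteq> bot" if "t \<in> I" for t
    using connected_imp_perfect[OF convex_connected[OF conv] that] False trivial_limit_within by blast
  have "\<exists>d. (h has_real_derivative d) (at t within I)" if "t \<in> I" for t
    using loc[OF that] that by force
  then obtain H where H: "\<And>t. t \<in> I \<Longrightarrow> (h has_real_derivative H t) (at t within I)"
    by metis
  have H': "\<exists>D\<ge>0. (H has_real_derivative D) (at t within I)" if t: "t \<in> I" for t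
  proof -
    obtain \<delta> h' D where d: "\<delta> > 0" "D \<ge> 0"
      and h': "\<And>s. s \<in> I \<Longrightarrow> \<bar>s - t\<bar> < \<delta> \<Longrightarrow> (h has_real_derivative h' s) (at s within I)"
      and D: "(h' has_real_derivative D) (at t within I)"
      using loc[OF t] by blast
    have "H s = h' s" if "s \<in> I" "\<bar>s - t\<bar> < \<delta>" for s
      using has_field_derivative_unique[OF H h' nonbot] that by blast
    then have "(H has_real_derivative D) (at t within I)"
      by (intro has_field_derivative_transform_within[OF D d(1) t]) (auto simp: dist_real_def)
    then show ?thesis using d by blast
  qed
  obtain K where K: "\<And>t. t \<in> I \<Longrightarrow> K t \<ge> 0" "\<And>t. t \<in> I \<Longrightarrow> (H has_real_derivative K t) (at t within I)"
    using bchoice[of I "\<lambda>t D. D \<ge> 0 \<and> (H has_real_derivative D) (at t within I)"] H' by blast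
  have sub: "{a..b} \<subseteq> I" if "a \<in> I" "b \<in> I" for a b
    using mem_is_interval_1_I[OF I that] by auto
  have mvt: "\<exists>z\<in>{a<..<b}. f b - f a = f' z * (b - a)"
    if "a \<in> I" "b \<in> I" "a < b" and f: "\<And>t. t \<in> I \<Longrightarrow> (f has_real_derivative f' t) (at t within I)" for a b f f'
  proof (rule mvt_simple[OF \<open>a < b\<close>])
    fix z assume "a \<le> z" "z \<le> b"
    then have "z \<in> I" using sub[OF that(1,2)] by auto
    then show "(f has_derivative (*) (f' z)) (at z within {a..b})"
      using DERIV_subset[OF f sub[OF that(1,2)]] by (simp add: has_field_derivative_def)
  qed
  have mono: "H a \<le> H b" if ab: "a \<in> I" "b \<in> I" "a \<le> b" for a b
  proof (cases "a = b")
    case False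
    then have "a < b" using ab by simp
    from mvt[OF ab(1,2) this K(2)] obtain z where z: "z \<in> {a<..<b}" "H b - H a = K z * (b - a)"
      by blast
    have "z \<in> I" using z sub[OF ab(1,2)] by auto
    then have "K z * (b - a) \<ge> 0" using K(1) ab by simp
    then show ?thesis using z by simp
  qed simp
  \<comment> \<open>The graph lies above its tangents.\<close>
  have above: "h a + H a * (b - a) \<le> h b" if ab: "a \<in> I" "b \<in> I" for a b
  proof -
    consider "a = b" | "a < b" | "b < a" by linarith
    then show ?thesis
    proof cases
      case 2
      then obtain z where z: "z \<in> {a<..<b}" "h b - h a = H z * (b - a)"
        using mvt[OF ab 2 H] by blast
      then have "H a \<le> H z" using sub[OF ab] ab by (intro mono) auto
      then have "H a * (b - a) \<le> H z * (b - a)" using 2 by (intro mult_right_mono) auto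
      then show ?thesis using z by linarith
    next
      case 3
      then obtain z where z: "z \<in> {b<..<a}" "h a - h b = H z * (a - b)"
        using mvt[OF ab(2,1) 3 H] by blast
      then have "H z \<le> H a" using sub[OF ab(2,1)] ab by (intro mono) auto
      then have "H z * (a - b) \<le> H a * (a - b)" using 3 by (intro mult_right_mono) auto
      then show ?thesis using z by (simp add: algebra_simps)
    qed simp
  qed
  show ?thesis
  proof (rule convex_onI)
    fix t x y :: real
    assume t: "0 < t" "t < 1" and xy: "x \<in> I" "y \<in> I"
    define z where "z = (1 - t) *\<^sub>R x + t *\<^sub>R y"
    have "z \<in> I"
      unfolding z_def using conv t xy by (intro convexD) auto
    have "(1 - t) * (h z + H z * (x - z)) + t * (h z + H z * (y - z)) \<le> (1 - t) * h x + t * h y"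
      using t above[OF \<open>z \<in> I\<close> xy(1)] above[OF \<open>z \<in> I\<close> xy(2)] by (intro add_mono mult_left_mono) auto
    moreover have "(1 - t) * (h z + H z * (x - z)) + t * (h z + H z * (y - z)) = h z + H z * ((1 - t) * x + t * y - z)"
      by (simp add: algebra_simps)
    ultimately show "h ((1 - t) *\<^sub>R x + t *\<^sub>R y) \<le> (1 - t) * h x + t * h y"
      by (simp add: z_def)
  qed (rule conv)
qed

section \<open>Geodesics of the condition metric\<close>

text \<open>A local parametrization of the solution variety, given by its lift to the spheres. The components of
  the lift are \<open>M\<close> and \<open>Z\<close>; the function \<open>f\<close> is \<open>1/\<alpha>\<^sub>2\<close>, and \<open>g\<close> is the metric.\<close>

locale W_chart =
  fixes U :: "('k::rc_scalar^'d) set" and F :: "'k^'d \<Rightarrow> ('k^'m^'n) \<times> ('k^'m)"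
  assumes card_m: "CARD('m) = CARD('n) + 1" and card_d: "CARD('d) = CARD('n) * CARD('m) - 1"
    and open_U: "open U" and smooth: "smooth_map_on U F" and lift: "F ` U \<subseteq> sphere_lift W_gt"
    and immersion: "\<And>x u. x \<in> U \<Longrightarrow> u \<noteq> 0 \<Longrightarrow> pullback_metric F x u u > 0"
begin

definition M where "M y = fst (F y)"
definition Z where "Z y = snd (F y)"
definition f where "f y = (sigma CARD('n) (M y))\<^sup>2"
definition g where "g y u w = mat_herm.lift_metric M y u w + vec_herm.lift_metric Z y u w"

lemma F_Ck: "Ck_on k U F" using smooth by (simp add: smooth_map_on_def)

lemma M_Ck: "Ck_on k U M"
  unfolding M_def[abs_def] by (rule Ck_on_bounded_linear[OF open_U bounded_linear_fst F_Ck])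

lemma Z_Ck: "Ck_on k U Z"
  unfolding Z_def[abs_def] by (rule Ck_on_bounded_linear[OF open_U bounded_linear_snd F_Ck])

lemma F_W: "y \<in> U \<Longrightarrow> F y \<in> sphere_lift W_gt" using lift by auto

lemmas at_point = sphere_lift_W_gt[OF card_m F_W, folded M_def Z_def, folded f_def]

lemma f_pos: "y \<in> U \<Longrightarrow> f y > 0"
  unfolding f_def by (rule zero_less_power[OF at_point(4)])

lemma f_Ck: "Ck_on k U f"
  unfolding f_def[abs_def] by (rule Ck_on_smallest_singular_value[OF open_U M_Ck at_point(5)])

lemma F_has_derivative: "x \<in> U \<Longrightarrow> (F has_derivative frechet_derivative F (at x)) (at x)"
  by (rule Ck_on_has_derivative[OF F_Ck[of "Suc 0"]])

lemma dir_F: "x \<in> U \<Longrightarrow> dir F u x = (dir M u x, dir Z u x)"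
  unfolding M_def[abs_def] Z_def[abs_def]
  by (simp add: dir_bounded_linear[OF bounded_linear_fst F_has_derivative]
      dir_bounded_linear[OF bounded_linear_snd F_has_derivative])

lemma tangent_M: "x \<in> U \<Longrightarrow> inner (dir M u x) (M x) = 0"
  by (rule unit_lift_derivatives(1)[OF open_U M_Ck at_point(1)])

lemma tangent_Z: "x \<in> U \<Longrightarrow> inner (dir Z u x) (Z x) = 0"
  by (rule unit_lift_derivatives(1)[OF open_U Z_Ck at_point(2)])

lemma pullback_metric_eq: "x \<in> U \<Longrightarrow> pullback_metric F x u w = g x u w"
  unfolding pullback_metric_def pp_metric_def g_def mat_herm.lift_metric_def vec_herm.lift_metric_def
  by (simp add: dir_F mat_herm.proj_metric_tangent[OF at_point(1) tangent_M tangent_M]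
      vec_herm.proj_metric_tangent[OF at_point(2) tangent_Z tangent_Z] flip: M_def Z_def)

lemma linearized_equation: 
  assumes x: "x \<in> U"
  shows "dir M w x *v Z x + M x *v dir Z w x = 0"
proof -
  have "((\<lambda>y. M y *v Z y) has_derivative (\<lambda>w. M x *v dir Z w x + dir M w x *v Z x)) (at x)"
    by (intro bounded_bilinear.FDERIV[OF bounded_bilinear_mat_vec] Ck_on_has_derivative[OF M_Ck[of "Suc 0"] x]
        Ck_on_has_derivative[OF Z_Ck[of "Suc 0"] x])
  moreover have "((\<lambda>y. M y *v Z y) has_derivative (\<lambda>w. 0)) (at x)"
    by (rule has_derivative_transform_within_open[OF has_derivative_const[of 0] open_U x]) (simp add: at_point)
  ultimately have "(\<lambda>w. M x *v dir Z w x + dir M w x *v Z x) = (\<lambda>w. 0)"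
    by (rule has_derivative_unique)
  from fun_cong[OF this, of w] show ?thesis by (simp add: add.commute)
qed

text \<open>Modulo vertical vectors, \<open>(W, 0)\<close> is the image of a chart vector.\<close>

lemma exists_horizontal_lift:
  assumes x: "x \<in> U" and W: "inner W (M x) = 0" "W *v Z x = 0"
  obtains w c c' where "inner c 1 = 0" "inner c' 1 = 0"
    "dir M w x = W - mat_scale c (M x)" "dir Z w x = c' *s Z x"
proof -
  have lin: "linear (frechet_derivative F (at x))"
    using bounded_linear.linear[OF has_derivative_bounded_linear[OF F_has_derivative[OF x]]] .
  have "\<exists>w c c'. inner c 1 = 0 \<and> inner c' 1 = 0 \<and>
      dir F w x = (W - mat_scale c (M x), c' *s Z x)"
  proof (rule tangent_space_contains[OF card_d lin at_point(1-3)[OF x]])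
    show "\<exists>c. b = c *s Z x" if "M x *v b = 0" for b
      using kernel_of_corank_one[OF card_m at_point(4,2,3)[OF x] that] by metis
    show "pp_metric (M x, Z x) (dir F w x) (dir F w x) > 0" if "w \<noteq> 0" for w
      using immersion[OF x that] by (simp add: pullback_metric_def M_def Z_def)
  qed (use W x in \<open>auto simp: dir_F tangent_M tangent_Z linearized_equation\<close>)
  then show thesis using that by (auto simp: dir_F[OF x])
qed

lemma g_differentiable:
  assumes "x \<in> U"
  shows "(\<lambda>y. mat_herm.lift_metric M y u w) differentiable (at x)"
    "(\<lambda>y. vec_herm.lift_metric Z y u w) differentiable (at x)"
    "(\<lambda>y. g y u w) differentiable (at x)"
proof -
  show M: "(\<lambda>y. mat_herm.lift_metric M y u w) differentiable (at x)"
    and Z: "(\<lambda>y. vec_herm.lift_metric Z y u w) differentiable (at x)"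
    using mat_herm.lift_metric_has_derivative[OF M_Ck assms] vec_herm.lift_metric_has_derivative[OF Z_Ck assms]
    unfolding differentiable_def by blast+
  show "(\<lambda>y. g y u w) differentiable (at x)"
    unfolding g_def by (rule differentiable_add[OF M Z])
qed

text \<open>The factor \<open>1/f\<close> is pulled out, which leaves logarithmic derivatives of \<open>f\<close>.\<close>

lemma christoffel_condition_metric:
  assumes x: "x \<in> U"
  shows "christoffel (\<lambda>y u w. alpha2 (pp_proj (F y)) * pullback_metric F y u w) x v v w
    = inverse (f x) * (christoffel (mat_herm.lift_metric M) x v v w + christoffel (vec_herm.lift_metric Z) x v v w
        - dir f v x / f x * g x v w + dir f w x / (2 * f x) * g x v v)"
proof -
  have fd: "(f has_derivative frechet_derivative f (at x)) (at x)"
    by (rule Ck_on_has_derivative[OF f_Ck[of "Suc 0"] x])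
  have inv: "((\<lambda>y. inverse (f y)) has_derivative (\<lambda>v. - (inverse (f x) * dir f v x * inverse (f x)))) (at x)"
    using f_pos[OF x] by (intro Deriv.has_derivative_inverse fd) simp
  have diff: "(\<lambda>y. inverse (f y) * g y u w) differentiable (at x)" for u w
    using inv by (intro differentiable_mult g_differentiable x) (auto simp: differentiable_def)
  have "christoffel (\<lambda>y u w. alpha2 (pp_proj (F y)) * pullback_metric F y u w) x v v w
      = christoffel (\<lambda>y u w. inverse (f y) * g y u w) x v v w"
    by (rule christoffel_cong[OF open_U x _ diff]) (simp add: at_point(6) pullback_metric_eq)
  also have "\<dots> = inverse (f x) * christoffel g x v v w
      + dir (\<lambda>y. inverse (f y)) v x * g x v w - dir (\<lambda>y. inverse (f y)) w x * g x v v / 2"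
    using inv by (intro christoffel_conformal g_differentiable x) (auto simp: differentiable_def)
  also have "christoffel g x v v w = christoffel (mat_herm.lift_metric M) x v v w + christoffel (vec_herm.lift_metric Z) x v v w"
    unfolding g_def[abs_def] by (rule christoffel_add) (rule g_differentiable[OF x])+
  also have "inverse (f x) * (christoffel (mat_herm.lift_metric M) x v v w + christoffel (vec_herm.lift_metric Z) x v v w)
      + dir (\<lambda>y. inverse (f y)) v x * g x v w - dir (\<lambda>y. inverse (f y)) w x * g x v v / 2
    = inverse (f x) * (christoffel (mat_herm.lift_metric M) x v v w + christoffel (vec_herm.lift_metric Z) x v v w
        - dir f v x / f x * g x v w + dir f w x / (2 * f x) * g x v v)"
    unfolding dir_eqI[OF inv] using f_pos[OF x] by (simp add: field_simps)
  finally show ?thesis .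
qed

text \<open>The premise is the geodesic equation with velocity \<open>v\<close> and acceleration \<open>z\<close> in the chart, and the
  bracket in the conclusion is the second derivative of \<open>f\<close> along such a curve.\<close>

theorem condition_geodesic_inequality:
  assumes x: "x \<in> U"
    and geo: "\<And>w. alpha2 (pp_proj (F x)) * pullback_metric F x z w
      + christoffel (\<lambda>y u w. alpha2 (pp_proj (F y)) * pullback_metric F y u w) x v v w = 0"
  shows "f x * (dir (dir f v) v x + dir f z x) \<le> (dir f v x)\<^sup>2"
proof -
  obtain u where u: "norm u = 1" and fu: "(norm (adjoint_mat (M x) *v u))\<^sup>2 = f x"
    using smallest_singular_value(3)[of "M x"] unfolding f_def by blast
  let ?T = "\<lambda>A. adjoint_mat A *v u"
  define Y where "Y = outer u (?T (M x))"
  define W where "W = Y - f x *\<^sub>R M x"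
  note grad = gradient_direction[OF at_point(1)[OF x] u fu[symmetric], folded Y_def]
  \<comment> \<open>The barrier, which touches \<open>f\<close> from above at \<open>x\<close>.\<close>
  define \<Phi> where "\<Phi> y = (norm (?T (M y)))\<^sup>2" for y
  have TM: "Ck_on 2 U (\<lambda>y. ?T (M y))"
    by (rule Ck_on_bounded_linear[OF open_U bounded_linear_adjoint_mult M_Ck])
  have \<Phi>2: "Ck_on 2 U \<Phi>"
    unfolding \<Phi>_def[abs_def] power2_norm_eq_inner
    by (rule Ck_on_bilinear[OF open_U bounded_bilinear_inner TM TM])
  have min: "\<Phi> x - f x \<le> \<Phi> y - f y" for y
    using smallest_singular_value(2)[of "M y" u] fu u by (simp add: \<Phi>_def f_def)
  note second = interior_minimum_second_order[OF open_U Ck_on_diff[OF open_U \<Phi>2 f_Ck] x min]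
  have dT: "dir (\<lambda>y. ?T (M y)) e x = ?T (dir M e x)" for e
    by (rule dir_bounded_linear[OF bounded_linear_adjoint_mult Ck_on_has_derivative[OF M_Ck[of "Suc 0"] x]])
  have ddT: "dir (dir (\<lambda>y. ?T (M y)) e) e' x = ?T (dir (dir M e) e' x)" for e e'
    by (rule dir_dir_bounded_linear[OF open_U bounded_linear_adjoint_mult M_Ck x])
  have df: "dir f e x = 2 * inner (dir M e x) Y" for e
  proof -
    have "dir \<Phi> e x = 2 * inner (dir M e x) Y"
      using dir_dir_norm_square(1)[OF open_U TM x, of e]
      by (simp add: \<Phi>_def[abs_def] dT inner_adjoint_mult Y_def)
    then show ?thesis
      using second(1)[of e] dir_dir_diff(1)[OF open_U \<Phi>2 f_Ck x, of e] by simp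
  qed
  have ddf: "dir (dir f v) v x \<le> 2 * (norm (?T (dir M v x)))\<^sup>2 + 2 * inner (dir (dir M v) v x) Y"
  proof -
    have "dir (dir \<Phi> v) v x = 2 * (norm (?T (dir M v x)))\<^sup>2 + 2 * inner (dir (dir M v) v x) Y"
      using dir_dir_norm_square(2)[OF open_U TM x, of v]
      by (simp add: \<Phi>_def[abs_def] dT ddT inner_adjoint_mult Y_def)
    then show ?thesis
      using second(2)[of v] dir_dir_diff(2)[OF open_U \<Phi>2 f_Ck x, of v v] by simp
  qed
  have WM: "inner W (M x) = 0"
    using grad(4) mat_herm.inner_hm_one[of W "M x"] by (simp add: W_def)
  have "W *v Z x = 0"
    using outer_adjoint_mult_kernel[OF at_point(3)[OF x], of u]
    by (simp add: W_def Y_def matrix_vector_mult_diff_rdistrib at_point(3)[OF x]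
        linear_scale[OF bounded_linear.linear[OF bounded_bilinear.bounded_linear_left[OF bounded_bilinear_mat_vec]]])
  from exists_horizontal_lift[OF x WM this] obtain w c c'
    where c: "inner c 1 = 0" and c': "inner c' 1 = 0"
      and Mw: "dir M w x = W - mat_scale c (M x)" and Zw: "dir Z w x = c' *s Z x" .
  note n = at_point(1,2)[OF x]
  define A where "A = dir (dir M v) v x + dir M z x"
  define q where "q = vec_herm.fubini_study (Z x) (dir Z v x) (dir Z v x)"
  \<comment> \<open>The vertical parts of the test vector do not contribute to any term of the geodesic equation.\<close>
  have fsM: "mat_herm.fubini_study (M x) B (dir M w x) = inner B W" for B
  proof -
    have "mat_herm.fubini_study (M x) B (dir M w x)
        = mat_herm.fubini_study (M x) B W - mat_herm.fubini_study (M x) B (mat_scale c (M x))"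
      by (simp add: Mw mat_herm.fubini_study_def mat_herm.hm.diff_left inner_diff_right)
    then show ?thesis
      using grad(4) by (simp add: mat_herm.fubini_study_vertical n mat_herm.fubini_study_horizontal W_def)
  qed
  have fsZ: "vec_herm.fubini_study (Z x) B (dir Z w x) = 0" for B
    by (simp add: Zw vec_herm.fubini_study_vertical n)
  have coM: "inner (mat_herm.hm (dir M v x) (M x)) (mat_herm.hm (dir M v x) (dir M w x))
      = inner (mat_herm.hm (dir M v x) (M x)) (mat_herm.hm (dir M v x) W)"
    by (simp add: Mw mat_herm.hm.diff_right inner_diff_right mat_herm.coriolis_vertical n c)
  have coZ: "inner (vec_herm.hm (dir Z v x) (Z x)) (vec_herm.hm (dir Z v x) (dir Z w x)) = 0"
    by (simp add: Zw vec_herm.coriolis_vertical n c')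
  have cM: "christoffel (mat_herm.lift_metric M) x v v w = inner (dir (dir M v) v x) W
      + 2 * inner (mat_herm.hm (dir M v x) (M x)) (mat_herm.hm (dir M v x) W)"
    by (subst mat_herm.christoffel_lift_metric[OF open_U M_Ck at_point(1) x]) (simp_all only: fsM coM)
  have cZ: "christoffel (vec_herm.lift_metric Z) x v v w = 0"
    by (subst vec_herm.christoffel_lift_metric[OF open_U Z_Ck at_point(2) x]) (simp_all add: fsZ coZ)
  have gw: "g x e w = inner (dir M e x) W" for e
    by (simp add: g_def mat_herm.lift_metric_def vec_herm.lift_metric_def fsM fsZ)
  have gv: "g x v v = mat_herm.fubini_study (M x) (dir M v x) (dir M v x) + q"
    by (simp add: g_def mat_herm.lift_metric_def vec_herm.lift_metric_def q_def)
  have "inner (dir M v x) W = inner (dir M v x) Y"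
    by (simp add: W_def inner_diff_right tangent_M x)
  then have dv: "dir f v x / f x * inner (dir M v x) W = 2 * (inner (dir M v x) Y)\<^sup>2 / f x"
    by (simp add: df power2_eq_square)
  have "dir f w x = 2 * f x * (1 - f x)"
    using grad(1-3) c by (simp add: df Mw W_def inner_diff_left algebra_simps)
  then have dw: "dir f w x / (2 * f x) = 1 - f x"
    using f_pos[OF x] by simp
  have "inverse (f x) * (g x z w + (christoffel (mat_herm.lift_metric M) x v v w + christoffel (vec_herm.lift_metric Z) x v v w
        - dir f v x / f x * g x v w + dir f w x / (2 * f x) * g x v v)) = 0"
    using geo[of w] unfolding christoffel_condition_metric[OF x] at_point(6)[OF x] pullback_metric_eq[OF x]
    by (simp add: distrib_left)
  then have "g x z w + (christoffel (mat_herm.lift_metric M) x v v w + christoffel (vec_herm.lift_metric Z) x v v w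
        - dir f v x / f x * g x v w + dir f w x / (2 * f x) * g x v v) = 0"
    using f_pos[OF x] by simp
  then have geo': "inner A W + 2 * inner (mat_herm.hm (dir M v x) (M x)) (mat_herm.hm (dir M v x) W)
      - 2 * (inner (dir M v x) Y)\<^sup>2 / f x + (1 - f x) * (mat_herm.fubini_study (M x) (dir M v x) (dir M v x) + q) = 0"
    unfolding cM cZ gw gv dv dw by (simp add: A_def inner_add_left)
  have AM: "inner A (M x) = - (norm (dir M v x))\<^sup>2"
    using unit_lift_derivatives(2)[OF open_U M_Ck at_point(1) x, of v v]
    by (simp add: A_def inner_add_left tangent_M x power2_norm_eq_inner)
  have "q \<ge> 0"
    by (simp add: q_def vec_herm.fubini_study_self n)
  from core_inequality[OF n(1) u fu[symmetric] f_pos[OF x] tangent_M[OF x] AM this, folded Y_def, folded W_def, OF geo']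
  have "f x * (2 * (norm (?T (dir M v x)))\<^sup>2 + 2 * inner A Y) \<le> (dir f v x)\<^sup>2"
    by (simp add: df)
  moreover have "dir (dir f v) v x + dir f z x \<le> 2 * (norm (?T (dir M v x)))\<^sup>2 + 2 * inner A Y"
    using ddf by (simp add: df[of z] A_def inner_add_left)
  ultimately show ?thesis
    using mult_left_mono[OF _ less_imp_le[OF f_pos[OF x]]] by (meson order_trans)
qed

end

text \<open>The second derivative of \<open>- ln f\<close> along a curve is \<open>(f'\<^sup>2 - f f'') / f\<^sup>2\<close>, to which the previous inequality
  applies at each time in a chart around the point.\<close>

theorem W_gt_self_convex:
  assumes card_m: "CARD('m::finite) = CARD('n::finite) + 1"
    and card_d: "CARD('d::finite) = CARD('n) * CARD('m) - 1"
  shows "self_convex (submanifold_charts W_gt :: ('k::rc_scalar^'d, ('k, 'm, 'n) pp_point) riem_chart set) alpha2"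
    (is "self_convex ?A _")
proof -
  have chart: "\<exists>U F. \<phi> = \<lparr>chart_dom = U, chart_map = (\<lambda>x. pp_proj (F x)), chart_metric = pullback_metric F\<rparr> \<and> W_chart U F"
    if "\<phi> \<in> ?A" for \<phi> :: "('k^'d, ('k, 'm, 'n) pp_point) riem_chart"
  proof -
    obtain U and F :: "'k^'d \<Rightarrow> ('k^'m^'n) \<times> ('k^'m)"
      where phi: "\<phi> = \<lparr>chart_dom = U, chart_map = (\<lambda>x. pp_proj (F x)), chart_metric = pullback_metric F\<rparr>"
      and F: "open U" "smooth_map_on U F" "F ` U \<subseteq> sphere_lift W_gt"
        "\<forall>x\<in>U. \<forall>u. u \<noteq> 0 \<longrightarrow> pullback_metric F x u u > 0"
      using \<open>\<phi> \<in> ?A\<close> unfolding submanifold_charts_def mem_Collect_eq by (elim exE conjE) (rule that)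
    have "W_chart U F"
      by unfold_locales (use F card_m card_d in auto)
    with phi show ?thesis by blast
  qed
  have smooth: "Ck_on 2 (chart_dom \<phi>) (\<lambda>x. alpha2 (chart_map \<phi> x)) \<and> (\<forall>x\<in>chart_dom \<phi>. alpha2 (chart_map \<phi> x) > 0)"
    if "\<phi> \<in> ?A" for \<phi> :: "('k^'d, ('k, 'm, 'n) pp_point) riem_chart"
  proof -
    obtain U F where phi: "\<phi> = \<lparr>chart_dom = U, chart_map = (\<lambda>x. pp_proj (F x)), chart_metric = pullback_metric F\<rparr>"
      and "W_chart U F"
      using chart[OF \<open>\<phi> \<in> ?A\<close>] by blast
    interpret W_chart U F by fact
    have "Ck_on 2 U (\<lambda>x. inverse (f x))"
      using f_pos by (intro Ck_on_inverse[OF open_U f_Ck]) force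
    then have "Ck_on 2 U (\<lambda>x. alpha2 (pp_proj (F x)))"
      by (rule Ck_on_cong[OF open_U, rotated]) (simp add: at_point(6))
    then show ?thesis
      by (simp add: phi at_point(6) f_pos)
  qed
  have convex: "convex_on I (\<lambda>t. ln (alpha2 (\<gamma> t)))" if geo: "geodesic (conformal_change alpha2 ?A) I \<gamma>" for I \<gamma>
  proof (rule convex_on_if_local_second_derivative)
    show "is_interval I" using geo by (simp add: geodesic_def)
    fix t assume t: "t \<in> I"
    obtain \<phi> \<delta> c c' c'' where phi: "\<phi> \<in> conformal_change alpha2 ?A" and d: "\<delta> > 0"
      and curve: "\<And>s. s \<in> I \<Longrightarrow> \<bar>s - t\<bar> < \<delta> \<Longrightarrow>
        c s \<in> chart_dom \<phi> \<and> \<gamma> s = chart_map \<phi> (c s) \<and>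
        (c has_vector_derivative c' s) (at s within I) \<and>
        (c' has_vector_derivative c'' s) (at s within I) \<and>
        (\<forall>w. chart_metric \<phi> (c s) (c'' s) w + christoffel (chart_metric \<phi>) (c s) (c' s) (c' s) w = 0)"
      using geo t unfolding geodesic_def by blast
    obtain \<psi> where psi: "\<psi> \<in> ?A"
      and phi_psi: "\<phi> = \<psi>\<lparr>chart_metric := (\<lambda>x u v. alpha2 (chart_map \<psi> x) * chart_metric \<psi> x u v)\<rparr>"
      using phi by (auto simp: conformal_change_def)
    obtain U F where UF: "\<psi> = \<lparr>chart_dom = U, chart_map = (\<lambda>x. pp_proj (F x)), chart_metric = pullback_metric F\<rparr>"
      and "W_chart U F"
      using chart[OF psi] by blast
    interpret W_chart U F by fact
    have cU: "c s \<in> U" and \<gamma>: "\<gamma> s = pp_proj (F (c s))"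
      and c1: "(c has_vector_derivative c' s) (at s within I)"
      and c2: "(c' has_vector_derivative c'' s) (at s within I)"
      and eq: "\<And>w. alpha2 (pp_proj (F (c s))) * pullback_metric F (c s) (c'' s) w
        + christoffel (\<lambda>y u w. alpha2 (pp_proj (F y)) * pullback_metric F y u w) (c s) (c' s) (c' s) w = 0"
      if "s \<in> I" "\<bar>s - t\<bar> < \<delta>" for s
      using curve[OF that] by (simp_all add: phi_psi UF)
    have h: "ln (alpha2 (\<gamma> s)) = - ln (f (c s))" if "s \<in> I" "\<bar>s - t\<bar> < \<delta>" for s
      using f_pos[OF cU[OF that]] by (simp add: \<gamma>[OF that] at_point(6)[OF cU[OF that]] ln_inverse)
    have f_curve: "((\<lambda>s. f (c s)) has_real_derivative dir f (c' s) (c s)) (at s within I)"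
      if "s \<in> I" "\<bar>s - t\<bar> < \<delta>" for s
      by (rule curve_first_derivative[OF Ck_on_has_derivative[OF f_Ck[of "Suc 0"] cU[OF that]] c1[OF that]])
    define h' where "h' s = - (dir f (c' s) (c s) / f (c s))" for s
    have "((\<lambda>t. ln (alpha2 (\<gamma> t))) has_real_derivative h' s) (at s within I)" if s: "s \<in> I" "\<bar>s - t\<bar> < \<delta>" for s
    proof -
      have "((\<lambda>s. - ln (f (c s))) has_real_derivative h' s) (at s within I)"
        unfolding h'_def using f_pos[OF cU[OF s]]
        by (auto intro!: derivative_eq_intros f_curve[OF s] simp: field_simps)
      then show ?thesis
      proof (rule has_field_derivative_transform_within)
        show "0 < \<delta> - \<bar>s - t\<bar>" using s by simp
        show "- ln (f (c r)) = ln (alpha2 (\<gamma> r))" if "r \<in> I" "dist r s < \<delta> - \<bar>s - t\<bar>" for r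
          using that by (intro h[symmetric]) (auto simp: dist_real_def)
      qed (use s in auto)
    qed
    moreover have tt: "\<bar>t - t\<bar> < \<delta>" using d by simp
    let ?D = "dir (dir f (c' t)) (c' t) (c t) + dir f (c'' t) (c t)"
    have "(h' has_real_derivative ((dir f (c' t) (c t))\<^sup>2 - f (c t) * ?D) / (f (c t))\<^sup>2) (at t within I)"
      unfolding h'_def using f_pos[OF cU[OF t tt]]
      by (auto intro!: derivative_eq_intros f_curve[OF t tt]
          curve_second_derivative[OF f_Ck open_U cU[OF t tt] t c1[OF t tt] c2[OF t tt]]
          simp: field_simps power2_eq_square)
    moreover have "((dir f (c' t) (c t))\<^sup>2 - f (c t) * ?D) / (f (c t))\<^sup>2 \<ge> 0"
      using condition_geodesic_inequality[OF cU[OF t tt] eq[OF t tt]] by simp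
    ultimately show "\<exists>\<delta>>0. \<exists>h'. \<exists>D\<ge>0.
      (\<forall>s\<in>I. \<bar>s - t\<bar> < \<delta> \<longrightarrow> ((\<lambda>t. ln (alpha2 (\<gamma> t))) has_real_derivative h' s) (at s within I)) \<and>
      (h' has_real_derivative D) (at t within I)"
      using d by blast
  qed
  show ?thesis
    using smooth convex by (auto simp: self_convex_def)
qed

theorem corollary8:
  assumes "CARD('m::finite) = CARD('n::finite) + 1"
    and "CARD('d::finite) = CARD('n) * CARD('m) - 1"
  shows "self_convex (submanifold_charts W_gt :: (real^'d, (real, 'm, 'n) pp_point) riem_chart set)
           alpha2 \<and>
         self_convex (submanifold_charts W_gt :: (complex^'d, (complex, 'm, 'n) pp_point) riem_chart set)
           alpha2"
  by (intro conjI W_gt_self_convex assms)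

end
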